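(* Fix a type $\Delta$. There exists an algorithm that determines whether for an input finite set $\mathcal D$ of $\Delta$-structures there exists a finite set $\mathcal F$ of $\Delta$-structures such that $(\mathcal F,\mathcal D)$ is a finite homomorphism duality.
   Context: A type is a finite family $\Delta=(\delta_i:i\in I)$ of integers $\delta_i\ge 2$. A $\Delta$-structure $A$ consists of a finite non-empty base set $\underline{A}$ and relations $R_i(A)\subseteq\underline{A}^{\delta_i}$ ($i\in I$). A homomorphism $A\to B$ is a map of base sets mapping $R_i(A)$ into $R_i(B)$ for every $i$; write $A\to B$ if one exists. $A,B$ are incomparable if $A\not\to B$ and $B\not\to A$. A core is a structure not homomorphic to any proper induced substructure of itself. A finite homomorphism duality is a pair $(\mathcal F,\mathcal D)$ of finite sets of core $\Delta$-structures such that distinct elements of $\mathcal F$ are incomparable, distinct elements of $\mathcal D$ are incomparable, and for every $\Delta$-structure $A$: there exists $F\in\mathcal F$ with $F\to A$ if and only if $A\not\to D$ for all $D\in\mathcal D$. *)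

theory Defs
  imports Main "HOL-Library.Nat_Bijection"
begin

section \<open>Relational structures\<close>

definition is_type :: "'i set \<Rightarrow> ('i \<Rightarrow> nat) \<Rightarrow> bool" where
  "is_type I \<delta> \<longleftrightarrow> finite I \<and> (\<forall>i\<in>I. \<delta> i \<ge> 2)"

text \<open>Tuples are lists; the length is fixed by the arity in \<open>is_structure\<close>.\<close>

datatype ('i, 'a) rstruct = RStruct (base: "'a set") (rel: "'i \<Rightarrow> 'a list set")

text \<open>The last conjunct normalises the irrelevant values of \<open>rel\<close> outside the index set, so that
  equality of HOL objects is equality of structures.\<close>

definition is_structure :: "'i set \<Rightarrow> ('i \<Rightarrow> nat) \<Rightarrow> ('i, 'a) rstruct \<Rightarrow> bool" where
  "is_structure I \<delta> A \<longleftrightarrow>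
     finite (base A) \<and> base A \<noteq> {} \<and>
     (\<forall>i\<in>I. rel A i \<subseteq> {t. length t = \<delta> i \<and> set t \<subseteq> base A}) \<and>
     (\<forall>i. i \<notin> I \<longrightarrow> rel A i = {})"

definition is_hom :: "'i set \<Rightarrow> ('i, 'a) rstruct \<Rightarrow> ('i, 'b) rstruct \<Rightarrow> ('a \<Rightarrow> 'b) \<Rightarrow> bool" where
  "is_hom I A B f \<longleftrightarrow>
     f ` base A \<subseteq> base B \<and> (\<forall>i\<in>I. \<forall>t\<in>rel A i. map f t \<in> rel B i)"

definition hom_to :: "'i set \<Rightarrow> ('i, 'a) rstruct \<Rightarrow> ('i, 'b) rstruct \<Rightarrow> bool" where
  "hom_to I A B \<longleftrightarrow> (\<exists>f. is_hom I A B f)"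

definition incomparable :: "'i set \<Rightarrow> ('i, 'a) rstruct \<Rightarrow> ('i, 'b) rstruct \<Rightarrow> bool" where
  "incomparable I A B \<longleftrightarrow> \<not> hom_to I A B \<and> \<not> hom_to I B A"

definition induced :: "('i, 'a) rstruct \<Rightarrow> 'a set \<Rightarrow> ('i, 'a) rstruct" where
  "induced A S = RStruct S (\<lambda>i. {t \<in> rel A i. set t \<subseteq> S})"

definition is_core :: "'i set \<Rightarrow> ('i, 'a) rstruct \<Rightarrow> bool" where
  "is_core I A \<longleftrightarrow> (\<forall>S. S \<noteq> {} \<and> S \<subset> base A \<longrightarrow> \<not> hom_to I A (induced A S))"

text \<open>The test structures \<open>A\<close> range over the element type \<open>'a\<close> of the two families. For infinite
  \<open>'a\<close>, in particular \<open>nat\<close>, these are all finite structures up to isomorphism.\<close>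

definition finite_duality ::
  "'i set \<Rightarrow> ('i \<Rightarrow> nat) \<Rightarrow> ('i, 'a) rstruct set \<Rightarrow> ('i, 'a) rstruct set \<Rightarrow> bool" where
  "finite_duality I \<delta> \<F> \<D> \<longleftrightarrow>
     finite \<F> \<and> finite \<D> \<and>
     (\<forall>F\<in>\<F>. is_structure I \<delta> F \<and> is_core I F) \<and>
     (\<forall>D\<in>\<D>. is_structure I \<delta> D \<and> is_core I D) \<and>
     (\<forall>F\<in>\<F>. \<forall>F'\<in>\<F>. F \<noteq> F' \<longrightarrow> incomparable I F F') \<and>
     (\<forall>D\<in>\<D>. \<forall>D'\<in>\<D>. D \<noteq> D' \<longrightarrow> incomparable I D D') \<and>
     (\<forall>A :: ('i, 'a) rstruct. is_structure I \<delta> A \<longrightarrow>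
        ((\<exists>F\<in>\<F>. hom_to I F A) \<longleftrightarrow> (\<forall>D\<in>\<D>. \<not> hom_to I A D)))"

section \<open>Computability\<close>

text \<open>\<open>recursive n f\<close>: the restriction of \<open>f\<close> to lists of length \<open>n\<close> is a total recursive function
  of \<open>n\<close> arguments. As minimisation is applied to regular functions only, no partial functions are
  needed; by Kleene's normal form theorem this yields exactly the total computable functions. Values
  at lists of other lengths are irrelevant, which is what rule \<open>ext\<close> says.\<close>

inductive recursive :: "nat \<Rightarrow> (nat list \<Rightarrow> nat) \<Rightarrow> bool" where
  zero: "recursive n (\<lambda>xs. 0)"
| succ: "recursive 1 (\<lambda>xs. Suc (hd xs))"
| proj: "k < n \<Longrightarrow> recursive n (\<lambda>xs. xs ! k)"
| comp: "recursive (length hs) g \<Longrightarrow> (\<forall>h\<in>set hs. recursive n h) \<Longrightarrow>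
    recursive n (\<lambda>xs. g (map (\<lambda>h. h xs) hs))"
| prim: "recursive n g \<Longrightarrow> recursive (Suc (Suc n)) h \<Longrightarrow>
    recursive (Suc n) (\<lambda>xs. rec_nat (g (tl xs)) (\<lambda>k r. h (k # r # tl xs)) (hd xs))"
| mini: "recursive (Suc n) f \<Longrightarrow> (\<forall>xs. length xs = n \<longrightarrow> (\<exists>y. f (y # xs) = 0)) \<Longrightarrow>
    recursive n (\<lambda>xs. LEAST y. f (y # xs) = 0)"
| ext: "recursive n f \<Longrightarrow> (\<forall>xs. length xs = n \<longrightarrow> g xs = f xs) \<Longrightarrow> recursive n g"

text \<open>The algorithm gets the code of an instance and has to answer 1 or 0; it halts on every natural
  number, but nothing is required of its answer on numbers that do not code an instance.\<close>

definition decidable_problem :: "('x \<Rightarrow> nat) \<Rightarrow> ('x \<Rightarrow> bool) \<Rightarrow> ('x \<Rightarrow> bool) \<Rightarrow> bool" where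
  "decidable_problem code is_instance P \<longleftrightarrow>
     (\<exists>f. recursive 1 f \<and> (\<forall>x. is_instance x \<longrightarrow> f [code x] = (if P x then 1 else 0)))"

section \<open>Coding of inputs\<close>

text \<open>The list \<open>ix\<close> enumerates the index set.\<close>

definition structure_code :: "'i list \<Rightarrow> ('i, nat) rstruct \<Rightarrow> nat" where
  "structure_code ix A =
     prod_encode (set_encode (base A),
       list_encode (map (\<lambda>i. set_encode (list_encode ` rel A i)) ix))"

definition family_code :: "'i list \<Rightarrow> ('i, nat) rstruct set \<Rightarrow> nat" where
  "family_code ix \<D> = set_encode (structure_code ix ` \<D>)"

definition structure_family :: "'i set \<Rightarrow> ('i \<Rightarrow> nat) \<Rightarrow> ('i, 'a) rstruct set \<Rightarrow> bool" where
  "structure_family I \<delta> \<D> \<longleftrightarrow> finite \<D> \<and> (\<forall>D\<in>\<D>. is_structure I \<delta> D)"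

lemma finite_rel:
  assumes "is_structure I \<delta> A"
  shows "finite (rel A i)"
proof (cases "i \<in> I")
  case True
  have "finite {t. set t \<subseteq> base A \<and> length t = \<delta> i}"
    using assms by (intro finite_lists_length_eq) (simp add: is_structure_def)
  then show ?thesis
    by (rule finite_subset[rotated]) (use assms True in \<open>auto simp: is_structure_def\<close>)
next
  case False
  then show ?thesis using assms by (simp add: is_structure_def)
qed

lemma structure_code_inj:
  assumes "set ix = I"
  shows "inj_on (structure_code ix) {A. is_structure I \<delta> A}"
proof (rule inj_onI)
  fix A B :: "('a, nat) rstruct"
  assume "A \<in> {A. is_structure I \<delta> A}" "B \<in> {A. is_structure I \<delta> A}"
  then have A: "is_structure I \<delta> A" and B: "is_structure I \<delta> B" by auto
  assume eq: "structure_code ix A = structure_code ix B"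
  from eq have "set_encode (base A) = set_encode (base B)"
    by (simp add: structure_code_def)
  then have base: "base A = base B"
    using A B by (simp add: set_encode_eq is_structure_def)
  have "rel A i = rel B i" for i
  proof (cases "i \<in> I")
    case True
    with eq assms have "set_encode (list_encode ` rel A i) = set_encode (list_encode ` rel B i)"
      by (auto simp: structure_code_def dest!: injD[OF inj_list_encode])
    then have "list_encode ` rel A i = list_encode ` rel B i"
      by (simp add: set_encode_eq finite_rel[OF A] finite_rel[OF B])
    then show ?thesis
      using inj_image_eq_iff[OF inj_list_encode[of UNIV]] by blast
  next
    case False
    then show ?thesis using A B by (simp add: is_structure_def)
  qed
  with base show "A = B" by (cases A; cases B) auto
qed

lemma family_code_inj:
  assumes "set ix = I"
  shows "inj_on (family_code ix) {\<D>. structure_family I \<delta> \<D>}"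
proof (rule inj_onI)
  fix \<D> \<E> :: "('a, nat) rstruct set"
  assume "\<D> \<in> {\<D>. structure_family I \<delta> \<D>}" "\<E> \<in> {\<D>. structure_family I \<delta> \<D>}"
    and "family_code ix \<D> = family_code ix \<E>"
  then have "structure_code ix ` \<D> = structure_code ix ` \<E>"
    and "\<D> \<subseteq> {A. is_structure I \<delta> A}" "\<E> \<subseteq> {A. is_structure I \<delta> A}"
    by (auto simp: family_code_def structure_family_def set_encode_eq)
  then show "\<D> = \<E>"
    using inj_on_image_eq_iff[OF structure_code_inj[OF assms]] by metis
qed

end

theory Submission
  imports Defs
begin

text \<open>
  The argument has two halves: a characterisation of the families \<open>\<D>\<close> that occur in a finite duality by
  conditions on finitely many finite objects, and a check that these conditions are recursive.

  Call a structure \<open>D\<close> boundedly obstructed if for some \<open>N\<close> every \<open>A\<close> without a homomorphism to \<open>D\<close> has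
  an induced substructure on at most \<open>N\<close> elements without one. A set \<open>\<D>\<close> of pairwise incomparable cores
  has a partner \<open>\<F>\<close> iff each \<open>D \<in> \<D>\<close> is boundedly obstructed. If it is, the union of the obstructions for
  the single \<open>D\<close> is small, and \<open>\<F>\<close> consists of the minimal cores among the small structures that map to
  no \<open>D\<close> (\<open>bounded_obstructions_duality\<close>). Conversely, if \<open>A\<close> does not map to \<open>D\<close>, then some
  \<open>F \<in> \<F>\<close> maps to the disjoint sum of \<open>A\<close> and \<open>D\<close>, and the part of \<open>F\<close> that lands in \<open>A\<close> is the
  obstruction (\<open>duality_bounded_obstructions\<close>). So the members of \<open>\<D>\<close> can be tested one at a time.

  A core \<open>D\<close> is boundedly obstructed iff it satisfies two conditions. The first is a homomorphism to
  \<open>D\<close> from its power structure, that is, arc consistency decides whether a structure maps to \<open>D\<close>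
  (tree duality). The second is a walk \<open>h\<^sub>0, \<dots>, h\<^sub>n\<close> from the first to the second projection
  among the maps from \<open>D \<times> D\<close> to \<open>D\<close>, in which \<open>h\<^sub>k\<close> may be used at one position of a tuple and
  \<open>h\<^sub>k\<^sub>+\<^sub>1\<close> at the others.

  Necessity of the walk (\<open>bounded_obstructions_linked\<close>): put \<open>n + 1\<close> layers of \<open>D \<times> D\<close> behind each other,
  collapse the first by the first and the last by the second projection. A small substructure misses a
  layer, so it maps to \<open>D\<close> by using one projection on each side of the gap; hence the whole stack maps
  to \<open>D\<close>. Necessity of tree duality (\<open>duality_power_structure\<close>): by a pigeonhole argument on many copies of an
  obstruction \<open>F\<close>, every incidence of an element and a tuple of \<open>F\<close> is a bridge (\<open>duality_splits\<close>), and
  for such forests arc consistency suffices (\<open>splits_hom\<close>).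

  Sufficiency (\<open>linked_bounded_obstructions\<close>): a walk of length \<open>n\<close> makes arc consistency stop after
  \<open>n + 1\<close> rounds, unless some element has lost all its values by then, because a locally consistent choice near an element and one far away from it can be
  blended along the walk (\<open>linked_surviving\<close>). A value that is deleted within a fixed number of rounds
  is deleted already in a substructure of bounded size (\<open>surviving_support\<close>).

  Both conditions, being a core and incomparability are statements with bounded quantifiers over codes.
  The existence of a walk of unspecified length becomes bounded as reachability: every set of maps that
  contains the first projection and is closed under steps contains the second projection.
\<close>

section \<open>Structures and homomorphisms\<close>

lemma is_hom_comp:
  "is_hom I A B f \<Longrightarrow> is_hom I B C g \<Longrightarrow> is_hom I A C (g \<circ> f)"
  unfolding is_hom_def by (metis (no_types, lifting) image_comp image_mono map_map order_trans)

lemma is_hom_base: "is_hom I A B f \<Longrightarrow> x \<in> base A \<Longrightarrow> f x \<in> base B"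
  and is_hom_rel: "is_hom I A B f \<Longrightarrow> i \<in> I \<Longrightarrow> t \<in> rel A i \<Longrightarrow> map f t \<in> rel B i"
  by (auto simp: is_hom_def)

lemma hom_to_trans: "hom_to I A B \<Longrightarrow> hom_to I B C \<Longrightarrow> hom_to I A C"
  using is_hom_comp unfolding hom_to_def by blast

lemma hom_to_refl: "hom_to I A A"
  unfolding hom_to_def is_hom_def by (intro exI[of _ id]) auto

lemma structure_finite: "is_structure I \<delta> A \<Longrightarrow> finite (base A)"
  and structure_nonempty: "is_structure I \<delta> A \<Longrightarrow> base A \<noteq> {}"
  and structure_length: "is_structure I \<delta> A \<Longrightarrow> t \<in> rel A i \<Longrightarrow> length t = \<delta> i"
  and structure_entries: "is_structure I \<delta> A \<Longrightarrow> t \<in> rel A i \<Longrightarrow> set t \<subseteq> base A"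
  and structure_index: "is_structure I \<delta> A \<Longrightarrow> t \<in> rel A i \<Longrightarrow> i \<in> I"
  by (auto simp: is_structure_def)

lemma structure_nth: "is_structure I \<delta> A \<Longrightarrow> t \<in> rel A i \<Longrightarrow> j < \<delta> i \<Longrightarrow> t ! j \<in> base A"
  using structure_length structure_entries nth_mem by (metis subsetD)

lemma induced_simps [simp]:
  "base (induced A S) = S" "rel (induced A S) i = {t \<in> rel A i. set t \<subseteq> S}"
  by (simp_all add: induced_def)

lemma induced_structure:
  "is_structure I \<delta> A \<Longrightarrow> S \<subseteq> base A \<Longrightarrow> S \<noteq> {} \<Longrightarrow> is_structure I \<delta> (induced A S)"
  by (auto simp: is_structure_def finite_subset)

lemma induced_mono: "S \<subseteq> T \<Longrightarrow> hom_to I (induced A S) (induced A T)"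
  unfolding hom_to_def is_hom_def by (intro exI[of _ id]) auto

lemma induced_hom_to: "S \<subseteq> base A \<Longrightarrow> hom_to I (induced A S) A"
  unfolding hom_to_def is_hom_def by (intro exI[of _ id]) auto

lemma is_hom_cong:
  assumes A: "is_structure I \<delta> A" and eq: "\<And>x. x \<in> base A \<Longrightarrow> f x = g x" and f: "is_hom I A B f"
  shows "is_hom I A B g"
proof -
  have "map f t = map g t" if "t \<in> rel A i" for t i
    using eq structure_entries[OF A that] by (intro map_cong) auto
  then show ?thesis using f eq unfolding is_hom_def by (metis image_cong)
qed

definition relabel :: "('a \<Rightarrow> 'b) \<Rightarrow> ('i, 'a) rstruct \<Rightarrow> ('i, 'b) rstruct" where
  "relabel e A = RStruct (e ` base A) (\<lambda>i. map e ` rel A i)"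

lemma relabel_simps [simp]:
  "base (relabel e A) = e ` base A" "rel (relabel e A) i = map e ` rel A i"
  by (simp_all add: relabel_def)

lemma relabel_structure: "is_structure I \<delta> A \<Longrightarrow> is_structure I \<delta> (relabel e A)"
  unfolding is_structure_def by (auto; blast)

lemma hom_relabel: "hom_to I A (relabel e A)"
  unfolding hom_to_def is_hom_def by (intro exI[of _ e]) auto

lemma map_inv_into:
  "inj_on e B \<Longrightarrow> set t \<subseteq> B \<Longrightarrow> map (inv_into B e) (map e t) = t"
  by (induction t) auto

lemma relabel_hom:
  assumes "is_structure I \<delta> A" "inj_on e (base A)"
  shows "hom_to I (relabel e A) A"
  unfolding hom_to_def is_hom_def
proof (intro exI conjI ballI)
  show "inv_into (base A) e ` base (relabel e A) \<subseteq> base A"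
    using assms(2) by auto
  fix i t assume "t \<in> rel (relabel e A) i"
  then obtain s where "s \<in> rel A i" "t = map e s" by auto
  then show "map (inv_into (base A) e) t \<in> rel A i"
    using map_inv_into[OF assms(2) structure_entries[OF assms(1)]] by simp
qed

section \<open>Cores\<close>

lemma core_endo_onto:
  assumes "is_structure I \<delta> A" "is_core I A" "is_hom I A A f"
  shows "f ` base A = base A"
proof (rule ccontr)
  assume "f ` base A \<noteq> base A"
  moreover have "f ` base A \<subseteq> base A" using assms(3) by (simp add: is_hom_def)
  ultimately have "\<not> hom_to I A (induced A (f ` base A))"
    using assms(2) structure_nonempty[OF assms(1)] unfolding is_core_def by (metis image_is_empty psubsetI)
  moreover have "is_hom I A (induced A (f ` base A)) f"
    using assms(3) structure_entries[OF assms(1)] unfolding is_hom_def by fastforce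
  ultimately show False unfolding hom_to_def by blast
qed

text \<open>An endomorphism of a core is bijective on elements, hence injective and, by finiteness, bijective on
  each relation; so its inverse preserves the relations as well.\<close>

lemma core_endo_inverse:
  assumes A: "is_structure I \<delta> A" and core: "is_core I A" and f: "is_hom I A A f"
  obtains g where "is_hom I A A g" "\<And>x. x \<in> base A \<Longrightarrow> g (f x) = x" "\<And>x. x \<in> base A \<Longrightarrow> f (g x) = x"
proof -
  let ?g = "inv_into (base A) f"
  have onto: "f ` base A = base A" by (rule core_endo_onto[OF A core f])
  then have inj: "inj_on f (base A)"
    using structure_finite[OF A] by (simp add: eq_card_imp_inj_on)
  have "map ?g t \<in> rel A i" if "t \<in> rel A i" "i \<in> I" for i t
  proof -
    have "inj_on (map f) (rel A i)"
      using inj structure_entries[OF A] by (intro inj_onI) (metis (no_types, lifting) map_inv_into)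
    moreover have "map f ` rel A i \<subseteq> rel A i" using f that by (auto simp: is_hom_def)
    ultimately have "map f ` rel A i = rel A i"
      using finite_rel[OF A] by (simp add: endo_inj_surj)
    with that(1) have "t \<in> map f ` rel A i" by simp
    then obtain s where "s \<in> rel A i" "t = map f s" by auto
    then show ?thesis using map_inv_into[OF inj structure_entries[OF A]] by simp
  qed
  then have "is_hom I A A ?g"
    using onto unfolding is_hom_def by (auto simp: inv_into_into)
  then show thesis
    using that[of ?g] inj onto by (simp add: f_inv_into_f)
qed

lemma core_iff_endo_inj:
  assumes A: "is_structure I \<delta> A"
  shows "is_core I A \<longleftrightarrow> (\<forall>f. is_hom I A A f \<longrightarrow> inj_on f (base A))"
proof
  assume "is_core I A"
  then show "\<forall>f. is_hom I A A f \<longrightarrow> inj_on f (base A)"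
    using core_endo_onto[OF A] structure_finite[OF A] by (simp add: eq_card_imp_inj_on)
next
  assume inj: "\<forall>f. is_hom I A A f \<longrightarrow> inj_on f (base A)"
  show "is_core I A"
    unfolding is_core_def hom_to_def
  proof (intro allI impI notI; elim exE conjE)
    fix S f assume S: "S \<subset> base A" and f: "is_hom I A (induced A S) f"
    then have "is_hom I A A f" by (fastforce simp: is_hom_def)
    with inj have "inj_on f (base A)" by blast
    then have "card (base A) \<le> card S"
      using f structure_finite[OF A] S by (intro card_inj_on_le[of f]) (auto simp: is_hom_def finite_subset)
    then show False using psubset_card_mono[OF structure_finite[OF A] S] by simp
  qed
qed

text \<open>The induced substructure of least size among those that receive a homomorphism from \<open>A\<close>.\<close>

lemma core_exists:
  assumes A: "is_structure I \<delta> A"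
  obtains S where "S \<noteq> {}" "S \<subseteq> base A" "hom_to I A (induced A S)" "is_core I (induced A S)"
proof -
  let ?P = "\<lambda>S. S \<noteq> {} \<and> S \<subseteq> base A \<and> hom_to I A (induced A S)"
  have "hom_to I A (induced A (base A))"
    unfolding hom_to_def is_hom_def
    using structure_entries[OF A] by (intro exI[of _ id]) auto
  then have "?P (base A)" using structure_nonempty[OF A] by simp
  then obtain S where S: "?P S" and least: "\<And>T. ?P T \<Longrightarrow> card S \<le> card T"
    using ex_has_least_nat[of ?P "base A" card] by blast
  have "is_core I (induced A S)"
    unfolding is_core_def
  proof (intro allI impI notI)
    fix T assume T: "T \<noteq> {} \<and> T \<subset> base (induced A S)"
      and hom: "hom_to I (induced A S) (induced (induced A S) T)"
    have "hom_to I (induced (induced A S) T) (induced A T)"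
      unfolding hom_to_def is_hom_def by (intro exI[of _ id]) auto
    then have "hom_to I A (induced A T)" using S hom hom_to_trans by blast
    then have "card S \<le> card T" using S T by (intro least) auto
    moreover have "card T < card S"
      using T S structure_finite[OF A] by (intro psubset_card_mono) (auto intro: finite_subset)
    ultimately show False by simp
  qed
  then show thesis using that S by blast
qed

section \<open>Dualities with several right-hand sides\<close>

text \<open>The obstruction is an induced substructure of \<open>A\<close> and not a structure from a fixed finite list, so
  that obstructions for several targets can be combined by taking the union of their base sets.\<close>

definition bounded_obstructions ::
  "'i set \<Rightarrow> ('i \<Rightarrow> nat) \<Rightarrow> nat \<Rightarrow> ('i, 'a) rstruct \<Rightarrow> bool" where
  "bounded_obstructions I \<delta> N D \<longleftrightarrow>
     (\<forall>A :: ('i, nat) rstruct. is_structure I \<delta> A \<longrightarrow> \<not> hom_to I A D \<longrightarrow>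
        (\<exists>S. S \<noteq> {} \<and> S \<subseteq> base A \<and> card S \<le> N \<and> \<not> hom_to I (induced A S) D))"

lemma nat_copy:
  assumes A: "is_structure I \<delta> A"
  obtains e :: "'a \<Rightarrow> nat" where "inj_on e (base A)" "e ` base A = {..<card (base A)}"
    "is_structure I \<delta> (relabel e A)" "hom_to I A (relabel e A)" "hom_to I (relabel e A) A"
proof -
  obtain e :: "'a \<Rightarrow> nat" and n where e: "e ` base A = {i. i < n}" "inj_on e (base A)"
    using finite_imp_inj_to_nat_seg[OF structure_finite[OF A]] by blast
  then have "card (base A) = n" by (metis card_image card_Collect_less_nat)
  then show thesis
    using that[OF e(2) _ relabel_structure[OF A] hom_relabel relabel_hom[OF A e(2)]] e(1)
    by (simp add: lessThan_def)
qed

text \<open>Test structures over an arbitrary element type reduce to those over \<open>nat\<close> by relabelling. This allows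
  products, sums and powers of structures as test structures below.\<close>

lemma bounded_obstructionsD:
  fixes A :: "('i, 'b) rstruct"
  assumes bo: "bounded_obstructions I \<delta> N D" and A: "is_structure I \<delta> A" and no: "\<not> hom_to I A D"
  obtains S where "S \<noteq> {}" "S \<subseteq> base A" "card S \<le> N" "\<not> hom_to I (induced A S) D"
proof -
  obtain e :: "'b \<Rightarrow> nat" where e: "inj_on e (base A)" "e ` base A = {..<card (base A)}"
    "is_structure I \<delta> (relabel e A)" "hom_to I A (relabel e A)" "hom_to I (relabel e A) A"
    by (rule nat_copy[OF A])
  then have "\<not> hom_to I (relabel e A) D" using no hom_to_trans by blast
  then obtain S where S: "S \<noteq> {}" "S \<subseteq> e ` base A" "card S \<le> N"
    and noS: "\<not> hom_to I (induced (relabel e A) S) D"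
    using bo e(3) unfolding bounded_obstructions_def by (metis relabel_simps(1))
  then obtain T where T: "T \<subseteq> base A" "S = e ` T" by (meson subset_imageE)
  have card: "card T = card S" using T e(1) by (metis card_image inj_on_subset)
  have "is_hom I (induced (relabel e A) S) (induced A T) (inv_into (base A) e)"
    unfolding is_hom_def
  proof (intro conjI ballI)
    show "inv_into (base A) e ` base (induced (relabel e A) S) \<subseteq> base (induced A T)"
      using T e(1) by (auto simp: subset_iff)
    fix i t assume "t \<in> rel (induced (relabel e A) S) i"
    then obtain s where s: "s \<in> rel A i" "t = map e s" "set t \<subseteq> S" by auto
    have "set s \<subseteq> T"
      using s T e(1) structure_entries[OF A s(1)] by (auto dest: inj_onD)
    then show "map (inv_into (base A) e) t \<in> rel (induced A T) i"
      using s map_inv_into[OF e(1) structure_entries[OF A]] by simp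
  qed
  then have "\<not> hom_to I (induced A T) D" using noS hom_to_trans unfolding hom_to_def by metis
  then show thesis using that[of T] S T card by auto
qed

lemma finite_dualityD:
  fixes A :: "('i, 'b) rstruct" and \<D> :: "('i, nat) rstruct set"
  assumes dual: "finite_duality I \<delta> \<F> \<D>" and A: "is_structure I \<delta> A"
  shows "(\<exists>F\<in>\<F>. hom_to I F A) \<longleftrightarrow> (\<forall>D\<in>\<D>. \<not> hom_to I A D)"
proof -
  obtain e :: "'b \<Rightarrow> nat" where e: "inj_on e (base A)" "e ` base A = {..<card (base A)}"
    "is_structure I \<delta> (relabel e A)" "hom_to I A (relabel e A)" "hom_to I (relabel e A) A"
    by (rule nat_copy[OF A])
  have "(\<exists>F\<in>\<F>. hom_to I F (relabel e A)) \<longleftrightarrow> (\<forall>D\<in>\<D>. \<not> hom_to I (relabel e A) D)"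
    using dual e(3) by (simp add: finite_duality_def)
  then show ?thesis using hom_to_trans[OF _ e(4)] hom_to_trans[OF _ e(5)] hom_to_trans[OF e(4)] hom_to_trans[OF e(5)]
    by blast
qed

definition disjoint_sum ::
  "('i, 'a) rstruct \<Rightarrow> ('i, 'b) rstruct \<Rightarrow> ('i, 'a + 'b) rstruct" where
  "disjoint_sum A B = RStruct (Inl ` base A \<union> Inr ` base B)
     (\<lambda>i. map Inl ` rel A i \<union> map Inr ` rel B i)"

lemma disjoint_sum_structure:
  "is_structure I \<delta> A \<Longrightarrow> is_structure I \<delta> B \<Longrightarrow> is_structure I \<delta> (disjoint_sum A B)"
  unfolding is_structure_def disjoint_sum_def by (auto; blast)

lemma disjoint_sum_upper:
  "hom_to I A (disjoint_sum A B)" "hom_to I B (disjoint_sum A B)"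
  unfolding hom_to_def is_hom_def disjoint_sum_def
  by (rule exI[of _ Inl], simp, rule exI[of _ Inr], simp)

text \<open>The disjoint sum with \<open>D\<close> turns a duality for the family into one for the single structure \<open>D\<close>:
  \<open>A + D\<close> maps to no member of the family other than \<open>D\<close>, by incomparability, and it maps to \<open>D\<close> iff
  \<open>A\<close> does. Elements of an obstruction that land in the summand \<open>D\<close> cause no trouble, so those that
  land in \<open>A\<close> form the obstruction in \<open>A\<close>; this set is nonempty as \<open>F\<close> itself does not map to \<open>D\<close>.\<close>

lemma duality_bounded_obstructions:
  fixes \<D> :: "('i, nat) rstruct set"
  assumes type: "is_type I \<delta>" and dual: "finite_duality I \<delta> \<F> \<D>" and D: "D \<in> \<D>"
  shows "\<exists>N. bounded_obstructions I \<delta> N D"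
proof -
  have strF: "is_structure I \<delta> F" if "F \<in> \<F>" for F using dual that by (simp add: finite_duality_def)
  have strD: "is_structure I \<delta> D" using dual D by (simp add: finite_duality_def)
  have finF: "finite \<F>" using dual by (simp add: finite_duality_def)
  let ?N = "\<Sum>F\<in>\<F>. card (base F)"
  have "bounded_obstructions I \<delta> ?N D"
    unfolding bounded_obstructions_def
  proof (intro allI impI)
    fix A :: "('i, nat) rstruct"
    assume A: "is_structure I \<delta> A" and no: "\<not> hom_to I A D"
    let ?AD = "disjoint_sum A D"
    have "\<not> hom_to I ?AD D'" if D': "D' \<in> \<D>" for D'
    proof
      assume hom: "hom_to I ?AD D'"
      then have "hom_to I D D'" using disjoint_sum_upper(2) hom_to_trans by blast
      then have "D = D'"
        using dual D D' by (auto simp: finite_duality_def incomparable_def)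
      then show False using hom disjoint_sum_upper(1) hom_to_trans no by blast
    qed
    then obtain F \<phi> where F: "F \<in> \<F>" and \<phi>: "is_hom I F ?AD \<phi>"
      using finite_dualityD[OF dual disjoint_sum_structure[OF A strD]] unfolding hom_to_def by blast
    have FD: "\<not> hom_to I F D"
      using finite_dualityD[OF dual strF[OF F]] F D hom_to_refl by blast
    define S where "S = {a \<in> base A. \<exists>x\<in>base F. \<phi> x = Inl a}"
    have noS: "\<not> (\<exists>g. is_hom I (induced A S) D g)"
    proof
      assume "\<exists>g. is_hom I (induced A S) D g"
      then obtain g where g: "is_hom I (induced A S) D g" by blast
      have "is_hom I F D (\<lambda>x. case \<phi> x of Inl a \<Rightarrow> g a | Inr d \<Rightarrow> d)"
        unfolding is_hom_def
      proof (intro conjI ballI)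
        show "(\<lambda>x. case \<phi> x of Inl a \<Rightarrow> g a | Inr d \<Rightarrow> d) ` base F \<subseteq> base D"
        proof (clarify)
          fix x assume x: "x \<in> base F"
          then have "\<phi> x \<in> base ?AD" using \<phi> by (auto simp: is_hom_def)
          then consider a where "a \<in> base A" "\<phi> x = Inl a" | d where "d \<in> base D" "\<phi> x = Inr d"
            by (auto simp: disjoint_sum_def)
          then show "(case \<phi> x of Inl a \<Rightarrow> g a | Inr d \<Rightarrow> d) \<in> base D"
          proof cases
            case (1 a)
            then have "a \<in> S" using x by (auto simp: S_def)
            then show ?thesis using 1 g by (auto simp: is_hom_def)
          qed simp
        qed
        fix i t assume i: "i \<in> I" and t: "t \<in> rel F i"
        have tF: "set t \<subseteq> base F" using structure_entries[OF strF[OF F] t] .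
        have split: "map (\<lambda>x. case \<phi> x of Inl a \<Rightarrow> g a | Inr d \<Rightarrow> d) t
            = map (\<lambda>y. case y of Inl a \<Rightarrow> g a | Inr d \<Rightarrow> d) (map \<phi> t)" by simp
        have "map \<phi> t \<in> rel ?AD i" using \<phi> i t by (simp add: is_hom_def)
        then consider s where "s \<in> rel A i" "map \<phi> t = map Inl s" | s where "s \<in> rel D i" "map \<phi> t = map Inr s"
          by (auto simp: disjoint_sum_def)
        then show "map (\<lambda>x. case \<phi> x of Inl a \<Rightarrow> g a | Inr d \<Rightarrow> d) t \<in> rel D i"
        proof cases
          case (1 s)
          have "set s \<subseteq> S"
          proof
            fix a assume a: "a \<in> set s"
            then have "Inl a \<in> set (map \<phi> t)" using 1 by auto
            then obtain x where "x \<in> set t" "\<phi> x = Inl a" by auto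
            then show "a \<in> S" using structure_entries[OF A 1(1)] a tF unfolding S_def by auto
          qed
          then have "map g s \<in> rel D i" using g i 1(1) by (simp add: is_hom_def)
          then show ?thesis unfolding split 1(2) by (simp add: comp_def)
        next
          case (2 s)
          then show ?thesis unfolding split 2(2) by (simp add: comp_def)
        qed
      qed
      then show False using FD unfolding hom_to_def by blast
    qed
    have "S \<noteq> {}"
    proof
      assume "S = {}"
      moreover have "[] \<notin> rel A i" if "i \<in> I" for i
        using type structure_length[OF A, of "[]" i] that by (fastforce simp: is_type_def)
      ultimately have "is_hom I (induced A S) D id" by (auto simp: is_hom_def)
      then show False using noS by blast
    qed
    moreover have "card S \<le> card (base F)"
    proof -
      have "Inl ` S \<subseteq> \<phi> ` base F" unfolding S_def by (auto simp: image_iff) metis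
      then have "card (Inl ` S :: (nat + nat) set) \<le> card (base F)"
        using structure_finite[OF strF[OF F]] by (meson card_image_le card_mono finite_imageI le_trans)
      then show ?thesis by (simp add: card_image)
    qed
    then have "card S \<le> ?N"
      using member_le_sum[OF F, of "\<lambda>F. card (base F)"] finF by simp
    ultimately show "\<exists>S. S \<noteq> {} \<and> S \<subseteq> base A \<and> card S \<le> ?N \<and> \<not> hom_to I (induced A S) D"
      using noS unfolding hom_to_def by (intro exI[of _ S]) (auto simp: S_def)
  qed
  then show ?thesis by blast
qed

lemma finite_preorder_antichain:
  assumes "finite G" "\<And>x. le x x" "\<And>x y z. le x y \<Longrightarrow> le y z \<Longrightarrow> le x z"
  shows "\<exists>M\<subseteq>G. (\<forall>f\<in>M. \<forall>f'\<in>M. f \<noteq> f' \<longrightarrow> \<not> le f f') \<and> (\<forall>g\<in>G. \<exists>f\<in>M. le f g)"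
  using assms(1)
proof (induction G rule: finite_induct)
  case empty
  then show ?case by blast
next
  case (insert g G)
  then obtain M where M: "M \<subseteq> G" "\<forall>f\<in>M. \<forall>f'\<in>M. f \<noteq> f' \<longrightarrow> \<not> le f f'" "\<forall>g\<in>G. \<exists>f\<in>M. le f g"
    by blast
  show ?case
  proof (cases "\<exists>f\<in>M. le f g")
    case True
    then show ?thesis using M by (intro exI[of _ M]) auto
  next
    case False
    have "\<exists>f\<in>insert g {f \<in> M. \<not> le g f}. le f x" if "x \<in> insert g G" for x
      using that M(3) assms(2,3) by blast
    then show ?thesis
      using M(1,2) False by (intro exI[of _ "insert g {f \<in> M. \<not> le g f}"]) auto
  qed
qed

lemma finite_structures:
  assumes "finite I" "finite V"
  shows "finite {A. is_structure I \<delta> A \<and> base A \<subseteq> V}"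
proof -
  let ?B = "\<Union>i\<in>I. Pow {t. set t \<subseteq> V \<and> length t = \<delta> i}"
  let ?R = "{r. \<forall>i. (i \<in> I \<longrightarrow> r i \<in> ?B) \<and> (i \<notin> I \<longrightarrow> r i = {})}"
  have "finite ?B" using assms finite_lists_length_eq by blast
  then have "finite ?R" by (rule finite_set_of_finite_funs[OF assms(1)])
  then have fin: "finite ((\<lambda>(B, r). RStruct B r) ` (Pow V \<times> ?R))" using assms(2) by blast
  have mem: "A \<in> (\<lambda>(B, r). RStruct B r) ` (Pow V \<times> ?R)"
    if "is_structure I \<delta> A" "base A \<subseteq> V" for A
  proof (rule image_eqI[of _ _ "(base A, rel A)"])
    show "A = (case (base A, rel A) of (B, r) \<Rightarrow> RStruct B r)" by simp
    have "rel A i \<in> ?B" if "i \<in> I" for i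
      using that \<open>is_structure I \<delta> A\<close> \<open>base A \<subseteq> V\<close>
      by (intro UN_I[of i]) (auto simp: is_structure_def subset_iff)
    then show "(base A, rel A) \<in> Pow V \<times> ?R"
      using that by (simp add: is_structure_def)
  qed
  have "{A. is_structure I \<delta> A \<and> base A \<subseteq> V} \<subseteq> (\<lambda>(B, r). RStruct B r) ` (Pow V \<times> ?R)"
    using mem by (intro subsetI) (simp only: mem_Collect_eq)
  then show ?thesis using fin by (rule finite_subset)
qed

lemma bounded_obstructions_duality:
  fixes \<D> :: "('i, nat) rstruct set"
  assumes type: "is_type I \<delta>" and fin: "finite \<D>"
    and str: "\<And>D. D \<in> \<D> \<Longrightarrow> is_structure I \<delta> D" and core: "\<And>D. D \<in> \<D> \<Longrightarrow> is_core I D"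
    and anti: "\<And>D D'. D \<in> \<D> \<Longrightarrow> D' \<in> \<D> \<Longrightarrow> D \<noteq> D' \<Longrightarrow> incomparable I D D'"
    and bo: "\<And>D. D \<in> \<D> \<Longrightarrow> \<exists>N. bounded_obstructions I \<delta> N D"
  shows "\<exists>\<F>. finite_duality I \<delta> \<F> \<D>"
proof -
  obtain n where n: "\<And>D. D \<in> \<D> \<Longrightarrow> bounded_obstructions I \<delta> (n D) D" using bo by metis
  define N where "N = Suc (\<Sum>D\<in>\<D>. n D)"
  define G where "G = {F :: ('i, nat) rstruct. is_structure I \<delta> F \<and> base F \<subseteq> {..<N} \<and> is_core I F
     \<and> (\<forall>D\<in>\<D>. \<not> hom_to I F D)}"
  have "finite I" using type by (simp add: is_type_def)
  then have "finite G"
    using finite_subset[OF _ finite_structures[of I "{..<N}" \<delta>], of G] by (auto simp: G_def)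
  then obtain \<F> where \<F>: "\<F> \<subseteq> G" "\<forall>F\<in>\<F>. \<forall>F'\<in>\<F>. F \<noteq> F' \<longrightarrow> \<not> hom_to I F F'"
    "\<forall>g\<in>G. \<exists>F\<in>\<F>. hom_to I F g"
    using finite_preorder_antichain[of G "hom_to I"] hom_to_refl hom_to_trans by metis
  have small: "\<exists>F\<in>G. hom_to I F A"
    if A: "is_structure I \<delta> A" and no: "\<forall>D\<in>\<D>. \<not> hom_to I A D" for A :: "('i, nat) rstruct"
  proof -
    have "\<exists>S. S \<subseteq> base A \<and> card S \<le> n D \<and> \<not> hom_to I (induced A S) D" if "D \<in> \<D>" for D
      using bounded_obstructionsD[OF n[OF that] A] no that by metis
    then obtain S where S: "\<And>D. D \<in> \<D> \<Longrightarrow> S D \<subseteq> base A" "\<And>D. D \<in> \<D> \<Longrightarrow> card (S D) \<le> n D"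
      "\<And>D. D \<in> \<D> \<Longrightarrow> \<not> hom_to I (induced A (S D)) D"
      by metis
    obtain v where v: "v \<in> base A" using structure_nonempty[OF A] by blast
    define T where "T = insert v (\<Union>D\<in>\<D>. S D)"
    have T: "T \<subseteq> base A" "T \<noteq> {}" using v S(1) by (auto simp: T_def)
    have "card (\<Union>D\<in>\<D>. S D) \<le> (\<Sum>D\<in>\<D>. card (S D))" by (rule card_UN_le[OF fin])
    also have "\<dots> \<le> (\<Sum>D\<in>\<D>. n D)" using S(2) by (rule sum_mono)
    finally have cardT: "card T \<le> N"
      unfolding T_def N_def using card_insert_le_m1 card_insert_if
      by (metis Suc_le_mono card.infinite card_insert_disjoint insert_absorb le_SucI le0 finite_insert)
    have strT: "is_structure I \<delta> (induced A T)" by (rule induced_structure[OF A T])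
    obtain e :: "nat \<Rightarrow> nat" where e: "inj_on e (base (induced A T))"
      "e ` base (induced A T) = {..<card (base (induced A T))}"
      "is_structure I \<delta> (relabel e (induced A T))" "hom_to I (induced A T) (relabel e (induced A T))"
      "hom_to I (relabel e (induced A T)) (induced A T)"
      by (rule nat_copy[OF strT])
    let ?B = "relabel e (induced A T)"
    obtain U where U: "U \<noteq> {}" "U \<subseteq> base ?B" "hom_to I ?B (induced ?B U)" "is_core I (induced ?B U)"
      by (rule core_exists[OF e(3)])
    have "\<not> hom_to I (induced ?B U) D" if "D \<in> \<D>" for D
    proof
      assume "hom_to I (induced ?B U) D"
      then have "hom_to I (induced A T) D" using hom_to_trans[OF e(4)] hom_to_trans[OF U(3)] by blast
      moreover have "hom_to I (induced A (S D)) (induced A T)"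
        using that by (intro induced_mono) (auto simp: T_def)
      ultimately show False using S(3)[OF that] hom_to_trans by blast
    qed
    moreover have "base (induced ?B U) \<subseteq> {..<N}" using U(2) e(2) cardT by auto
    ultimately have "induced ?B U \<in> G"
      using induced_structure[OF e(3) U(2,1)] U(4) by (simp only: G_def mem_Collect_eq) blast
    moreover have "hom_to I (induced ?B U) A"
      using hom_to_trans[OF induced_hom_to[OF U(2)] hom_to_trans[OF e(5) induced_hom_to[OF T(1)]]] .
    ultimately show ?thesis by (rule bexI[rotated])
  qed
  have "finite_duality I \<delta> \<F> \<D>"
    unfolding finite_duality_def
  proof (intro conjI ballI impI allI)
    show "finite \<F>" using \<F>(1) \<open>finite G\<close> finite_subset by blast
    fix A :: "('i, nat) rstruct"
    assume A: "is_structure I \<delta> A"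
    show "(\<exists>F\<in>\<F>. hom_to I F A) = (\<forall>D\<in>\<D>. \<not> hom_to I A D)"
    proof
      assume "\<exists>F\<in>\<F>. hom_to I F A"
      then obtain F where "F \<in> G" "hom_to I F A" using \<F>(1) by blast
      then show "\<forall>D\<in>\<D>. \<not> hom_to I A D" using hom_to_trans unfolding G_def by blast
    next
      assume "\<forall>D\<in>\<D>. \<not> hom_to I A D"
      then obtain F where "F \<in> G" "hom_to I F A" using small[OF A] by blast
      then show "\<exists>F\<in>\<F>. hom_to I F A" using \<F>(3) hom_to_trans by blast
    qed
  qed (use fin str core anti \<F>(1,2) in \<open>auto simp: G_def incomparable_def\<close>)
  then show ?thesis by blast
qed

section \<open>Linking the two projections\<close>

text \<open>Mixing \<open>h\<close> and \<open>h'\<close> is demanded only for the pattern in which \<open>h\<close> occurs at a single position \<open>j\<close>: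
  this is how the two meet when \<open>h\<close> is used at an element and \<open>h'\<close> at all its neighbours.\<close>

definition link_step :: "'i set \<Rightarrow> ('i, 'a) rstruct \<Rightarrow> ('a \<Rightarrow> 'a \<Rightarrow> 'a) \<Rightarrow> ('a \<Rightarrow> 'a \<Rightarrow> 'a) \<Rightarrow> bool" where
  "link_step I D h h' \<longleftrightarrow>
     (\<forall>x\<in>base D. \<forall>y\<in>base D. h' x y \<in> base D) \<and>
     (\<forall>i\<in>I. \<forall>a\<in>rel D i. \<forall>b\<in>rel D i. \<forall>j<length a.
        map (\<lambda>l. if l = j then h (a ! l) (b ! l) else h' (a ! l) (b ! l)) [0..<length a] \<in> rel D i)"

definition linked_projections ::
  "'i set \<Rightarrow> ('i, 'a) rstruct \<Rightarrow> nat \<Rightarrow> (nat \<Rightarrow> 'a \<Rightarrow> 'a \<Rightarrow> 'a) \<Rightarrow> bool" where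
  "linked_projections I D n h \<longleftrightarrow>
     (\<forall>x\<in>base D. \<forall>y\<in>base D. h 0 x y = x \<and> h n x y = y) \<and>
     (\<forall>k<n. link_step I D (h k) (h (Suc k)))"

text \<open>The stack \<open>G\<close> of layers of \<open>D \<times> D\<close> has tuples only within two consecutive layers. The map \<open>q\<close> gives
  normal forms for the identifications: the outer layers collapse to \<open>D\<close>, and the diagonal elements
  of all layers coincide, which makes both outer layers the same copy of \<open>D\<close>. A homomorphism from \<open>G\<close> to
  \<open>D\<close> restricts to an automorphism on that copy, because \<open>D\<close> is a core, and after undoing the automorphism its
  restrictions to the layers are the required walk.\<close>

lemma bounded_obstructions_linked:
  fixes D :: "('i, nat) rstruct"
  assumes D: "is_structure I \<delta> D" and core: "is_core I D"
    and bo: "bounded_obstructions I \<delta> N D"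
  shows "\<exists>n h. linked_projections I D n h"
proof -
  \<comment> \<open>There are \<open>n - 1 = N + 1\<close> inner layers, one more than an obstruction can meet.\<close>
  define n where "n = N + 2"
  define q where "q x y k = (if x = y \<or> k = 0 then (x, x, 0) else if k = n then (y, y, 0) else (x, y, k))"
    for x y k :: nat
  define G where "G = RStruct ((\<lambda>(x, y, k). q x y k) ` (base D \<times> base D \<times> {..n}))
     (\<lambda>i. {map (\<lambda>l. q (a ! l) (b ! l) (c l)) [0..<\<delta> i] |a b c.
        a \<in> rel D i \<and> b \<in> rel D i \<and> (\<exists>k<n. \<forall>l<\<delta> i. c l = k \<or> c l = Suc k)})"
  have relG: "map (\<lambda>l. q (a ! l) (b ! l) (c l)) [0..<\<delta> i] \<in> rel G i"
    if "a \<in> rel D i" "b \<in> rel D i" "k < n" "\<And>l. l < \<delta> i \<Longrightarrow> c l = k \<or> c l = Suc k" for a b c i k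
    using that unfolding G_def by auto
  have baseG: "q x y k \<in> base G" if "x \<in> base D" "y \<in> base D" "k \<le> n" for x y k
    using that unfolding G_def by force
  have G: "is_structure I \<delta> G"
    unfolding is_structure_def
  proof (intro conjI ballI allI impI)
    show "finite (base G)" "base G \<noteq> {}"
      using structure_finite[OF D] structure_nonempty[OF D] by (simp_all add: G_def)
    show "rel G i = {}" if "i \<notin> I" for i
      using structure_index[OF D] that by (auto simp: G_def)
    fix i assume "i \<in> I"
    show "rel G i \<subseteq> {t. length t = \<delta> i \<and> set t \<subseteq> base G}"
    proof
      fix t assume "t \<in> rel G i"
      then obtain a b c k where t: "t = map (\<lambda>l. q (a ! l) (b ! l) (c l)) [0..<\<delta> i]"
        and "a \<in> rel D i" "b \<in> rel D i" "k < n" "\<forall>l<\<delta> i. c l = k \<or> c l = Suc k"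
        by (auto simp: G_def)
      moreover from this have "c l \<le> n" if "l < \<delta> i" for l using that by force
      ultimately show "t \<in> {t. length t = \<delta> i \<and> set t \<subseteq> base G}"
        using structure_nth[OF D] baseG by auto
    qed
  qed
  have "hom_to I G D"
  proof (rule ccontr)
    assume "\<not> hom_to I G D"
    then obtain S where S: "S \<subseteq> base G" "card S \<le> N" and no: "\<not> hom_to I (induced G S) D"
      using bounded_obstructionsD[OF bo G] by metis
    have finS: "finite S" using S(1) structure_finite[OF G] finite_subset by blast
    have "card ((\<lambda>(x, y, k). k) ` S) \<le> N" using card_image_le[OF finS] S(2) le_trans by blast
    then have "\<not> {1..<n} \<subseteq> (\<lambda>(x, y, k). k) ` S"
      using card_mono[of "(\<lambda>(x, y, k). k) ` S" "{1..<n}"] finS by (auto simp: n_def)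
    then obtain m where "m \<in> {1..<n}" and notin: "m \<notin> (\<lambda>(x, y, k). k) ` S" by blast
    then have m: "0 < m" "m < n" by simp_all
    have unused: "(x, y, m) \<notin> S" for x y
      using notin by force
    define \<phi> where "\<phi> = (\<lambda>(x, y, k). if k < m then x else y :: nat)"
    have low: "\<phi> (q x y k) = x" if "q x y k \<in> S" "k \<le> m" for x y k
      using that m unused by (cases "k = m") (auto simp: q_def \<phi>_def split: if_splits)
    have high: "\<phi> (q x y k) = y" if "q x y k \<in> S" "m \<le> k" for x y k
      using that m unused by (cases "k = m") (auto simp: q_def \<phi>_def split: if_splits)
    have "is_hom I (induced G S) D \<phi>"
      unfolding is_hom_def
    proof (intro conjI ballI)
      show "\<phi> ` base (induced G S) \<subseteq> base D"
        using S(1) by (auto simp: G_def \<phi>_def q_def split: if_splits)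
      fix i t assume i: "i \<in> I" and "t \<in> rel (induced G S) i"
      then have "t \<in> rel G i" and tS: "set t \<subseteq> S" by auto
      then obtain a b c k where t: "t = map (\<lambda>l. q (a ! l) (b ! l) (c l)) [0..<\<delta> i]"
        and ab: "a \<in> rel D i" "b \<in> rel D i" and c: "\<forall>l<\<delta> i. c l = k \<or> c l = Suc k"
        by (auto simp: G_def)
      have inS: "q (a ! l) (b ! l) (c l) \<in> S" if "l < \<delta> i" for l using tS t that by auto
      show "map \<phi> t \<in> rel D i"
      proof (cases "k < m")
        case True
        have "map \<phi> t = map ((!) a) [0..<\<delta> i]" unfolding t
          using low[OF inS] c True by force
        then show ?thesis using ab structure_length[OF D] by (metis map_nth)
      next
        case False
        have "map \<phi> t = map ((!) b) [0..<\<delta> i]" unfolding t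
          using high[OF inS] c False by force
        then show ?thesis using ab structure_length[OF D] by (metis map_nth)
      qed
    qed
    then show False using no unfolding hom_to_def by blast
  qed
  then obtain g where g: "is_hom I G D g" unfolding hom_to_def by blast
  have n0: "0 < n" by (simp add: n_def)
  have "is_hom I D D (\<lambda>x. g (q x x 0))"
    unfolding is_hom_def
  proof (intro conjI ballI)
    show "(\<lambda>x. g (q x x 0)) ` base D \<subseteq> base D"
      using g baseG by (auto simp: is_hom_def)
    fix i t assume i: "i \<in> I" and t: "t \<in> rel D i"
    have "map g (map (\<lambda>l. q (t ! l) (t ! l) 0) [0..<\<delta> i]) \<in> rel D i"
      using relG[OF t t n0, of "\<lambda>_. 0"] by (intro is_hom_rel[OF g i]) simp
    moreover have "map (\<lambda>x. g (q x x 0)) t = map (\<lambda>l. g (q (t ! l) (t ! l) 0)) [0..<\<delta> i]"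
      using structure_length[OF D t] by (intro nth_equalityI) auto
    ultimately show "map (\<lambda>x. g (q x x 0)) t \<in> rel D i" by (simp add: comp_def)
  qed
  then obtain r where r: "is_hom I D D r" "\<And>x. x \<in> base D \<Longrightarrow> r (g (q x x 0)) = x"
    "\<And>x. x \<in> base D \<Longrightarrow> g (q (r x) (r x) 0) = x"
    by (rule core_endo_inverse[OF D core]) blast
  define h where "h k x y = r (g (q x y k))" for k x y
  have "linked_projections I D n h"
    unfolding linked_projections_def link_step_def
  proof (intro conjI ballI allI impI)
    fix x y assume xy: "x \<in> base D" "y \<in> base D"
    have "q x y 0 = q x x 0" "q x y n = q y y 0" using n0 by (auto simp: q_def)
    then show "h 0 x y = x" "h n x y = y" using r(2) xy by (simp_all add: h_def)
    show "h (Suc k) x y \<in> base D" if "k < n" for k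
      using that unfolding h_def by (intro is_hom_base[OF r(1)] is_hom_base[OF g] baseG xy) simp
  next
    fix k i a b j
    assume k: "k < n" and i: "i \<in> I" and a: "a \<in> rel D i" and b: "b \<in> rel D i" and "j < length a"
    have len: "length a = \<delta> i" using structure_length[OF D a] .
    have "map (\<lambda>l. q (a ! l) (b ! l) (if l = j then k else Suc k)) [0..<\<delta> i] \<in> rel G i"
      using a b k by (intro relG) auto
    then have "map r (map g (map (\<lambda>l. q (a ! l) (b ! l) (if l = j then k else Suc k)) [0..<\<delta> i])) \<in> rel D i"
      by (intro is_hom_rel[OF r(1) i] is_hom_rel[OF g i])
    moreover have "map r (map g (map (\<lambda>l. q (a ! l) (b ! l) (if l = j then k else Suc k)) [0..<\<delta> i]))
       = map (\<lambda>l. if l = j then h k (a ! l) (b ! l) else h (Suc k) (a ! l) (b ! l)) [0..<length a]"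
      by (simp add: h_def len)
    ultimately show "map (\<lambda>l. if l = j then h k (a ! l) (b ! l) else h (Suc k) (a ! l) (b ! l)) [0..<length a] \<in> rel D i"
      by simp
  qed
  then show ?thesis by blast
qed

section \<open>Arc consistency\<close>

text \<open>A homomorphism from \<open>A\<close> to the power structure is an assignment of nonempty lists of values that is
  arc consistent: every value in the list of an element extends to each tuple through that element.\<close>

definition power_structure :: "'i set \<Rightarrow> ('i \<Rightarrow> nat) \<Rightarrow> ('i, 'a) rstruct \<Rightarrow> ('i, 'a set) rstruct" where
  "power_structure I \<delta> D = RStruct {S. S \<noteq> {} \<and> S \<subseteq> base D}
     (\<lambda>i. {Ss. i \<in> I \<and> length Ss = \<delta> i \<and> set Ss \<subseteq> {S. S \<noteq> {} \<and> S \<subseteq> base D} \<and>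
        (\<forall>j<\<delta> i. \<forall>d\<in>Ss ! j. \<exists>s\<in>rel D i. s ! j = d \<and> (\<forall>l<\<delta> i. s ! l \<in> Ss ! l))})"

lemma power_structure_structure:
  "is_structure I \<delta> D \<Longrightarrow> is_structure I \<delta> (power_structure I \<delta> D)"
  by (auto simp: is_structure_def power_structure_def)

text \<open>The values for \<open>v\<close> that survive \<open>k\<close> rounds of deletion, that is, those taken at the root by homomorphisms to
  \<open>D\<close> from the tree of walks of length at most \<open>k\<close> in \<open>A\<close> that start in \<open>v\<close>. In accordance with the tree, the value at
  position \<open>j\<close> is constrained only by the neighbours at the other positions.\<close>

primrec surviving :: "'i set \<Rightarrow> ('i \<Rightarrow> nat) \<Rightarrow> ('i, 'a) rstruct \<Rightarrow> ('i, 'b) rstruct \<Rightarrow> nat \<Rightarrow> 'b \<Rightarrow> 'a set" where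
  "surviving I \<delta> D A 0 v = base D"
| "surviving I \<delta> D A (Suc k) v = {d \<in> base D. \<forall>i\<in>I. \<forall>t\<in>rel A i. \<forall>j<\<delta> i. t ! j = v \<longrightarrow>
     (\<exists>s\<in>rel D i. s ! j = d \<and> (\<forall>l<\<delta> i. l \<noteq> j \<longrightarrow> s ! l \<in> surviving I \<delta> D A k (t ! l)))}"

lemma surviving_base: "surviving I \<delta> D A k v \<subseteq> base D"
  by (cases k) auto

lemma surviving_baseD: "d \<in> surviving I \<delta> D A k v \<Longrightarrow> d \<in> base D"
  using surviving_base by (rule subsetD)

lemma survivingI:
  assumes "d \<in> base D"
    "\<And>i t j. i \<in> I \<Longrightarrow> t \<in> rel A i \<Longrightarrow> j < \<delta> i \<Longrightarrow> t ! j = v \<Longrightarrow>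
      \<exists>s\<in>rel D i. s ! j = d \<and> (\<forall>l<\<delta> i. l \<noteq> j \<longrightarrow> s ! l \<in> surviving I \<delta> D A k (t ! l))"
  shows "d \<in> surviving I \<delta> D A (Suc k) v"
  using assms by simp

lemma survivingE:
  assumes "d \<in> surviving I \<delta> D A (Suc k) (t ! j)" "i \<in> I" "t \<in> rel A i" "j < \<delta> i"
  obtains s where "s \<in> rel D i" "s ! j = d"
    "\<And>l. l < \<delta> i \<Longrightarrow> l \<noteq> j \<Longrightarrow> s ! l \<in> surviving I \<delta> D A k (t ! l)"
proof -
  have "\<exists>s\<in>rel D i. s ! j = d \<and> (\<forall>l<\<delta> i. l \<noteq> j \<longrightarrow> s ! l \<in> surviving I \<delta> D A k (t ! l))"
    using assms by simp
  then show thesis using that by blast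
qed

lemma hom_surviving:
  assumes A: "is_structure I \<delta> A" and f: "is_hom I A D f"
  shows "v \<in> base A \<Longrightarrow> f v \<in> surviving I \<delta> D A k v"
proof (induction k arbitrary: v)
  case 0
  then show ?case using f by (simp add: is_hom_base)
next
  case (Suc k)
  show ?case
  proof (rule survivingI)
    show "f v \<in> base D" using is_hom_base[OF f Suc.prems] .
    fix i t j assume t: "i \<in> I" "t \<in> rel A i" "j < \<delta> i" "t ! j = v"
    have "map f t \<in> rel D i" using is_hom_rel[OF f t(1,2)] .
    moreover have "length t = \<delta> i" using structure_length[OF A t(2)] .
    ultimately show "\<exists>s\<in>rel D i. s ! j = f v \<and> (\<forall>l<\<delta> i. l \<noteq> j \<longrightarrow> s ! l \<in> surviving I \<delta> D A k (t ! l))"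
      using t Suc.IH structure_nth[OF A t(2)] by (intro bexI[of _ "map f t"]) auto
  qed
qed

text \<open>Think of a tree of depth \<open>n + 2\<close> with one homomorphism that is valid except at the leaves and another that is
  valid except at the root. At the elements with \<open>p\<close> levels left for the first one, the combination by
  \<open>h\<^sub>n\<^sub>-\<^sub>p\<close> is used; it follows the first map near the root and the second one at the leaves.\<close>

lemma linked_surviving:
  assumes D: "is_structure I \<delta> D" and A: "is_structure I \<delta> A"
    and link: "linked_projections I D n h"
  shows "p \<le> n \<Longrightarrow> a \<in> surviving I \<delta> D A p v \<Longrightarrow> b \<in> surviving I \<delta> D A (Suc p) v \<Longrightarrow>
    h (n - p) a b \<in> surviving I \<delta> D A (Suc p) v"
proof (induction p arbitrary: a b v)
  case 0
  have "a \<in> base D" "b \<in> base D" using 0 by (auto dest: surviving_baseD)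
  then have "h n a b = b" using link by (simp add: linked_projections_def)
  then show ?case using 0 by simp
next
  case (Suc p)
  have ab: "a \<in> base D" "b \<in> base D" using Suc.prems by (auto intro: surviving_baseD simp del: surviving.simps)
  define k where "k = n - Suc p"
  have k: "k < n" "Suc k = n - p" using Suc.prems(1) by (auto simp: k_def)
  then have step: "link_step I D (h k) (h (Suc k))" using link unfolding linked_projections_def by blast
  have "h k a b \<in> base D"
  proof (cases k)
    case 0
    then show ?thesis using link ab by (simp add: linked_projections_def)
  next
    case (Suc k')
    then have "link_step I D (h k') (h k)" using link k by (simp add: linked_projections_def)
    then show ?thesis using ab by (simp add: link_step_def)
  qed
  then have "h k a b \<in> surviving I \<delta> D A (Suc (Suc p)) v"
  proof (rule survivingI)
    fix i t j assume t: "i \<in> I" "t \<in> rel A i" "j < \<delta> i" and v: "t ! j = v"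
    obtain r where r: "r \<in> rel D i" "r ! j = a"
      "\<And>l. l < \<delta> i \<Longrightarrow> l \<noteq> j \<Longrightarrow> r ! l \<in> surviving I \<delta> D A p (t ! l)"
      by (rule survivingE[OF Suc.prems(2)[folded v] t]) blast
    obtain s where s: "s \<in> rel D i" "s ! j = b"
      "\<And>l. l < \<delta> i \<Longrightarrow> l \<noteq> j \<Longrightarrow> s ! l \<in> surviving I \<delta> D A (Suc p) (t ! l)"
      by (rule survivingE[OF Suc.prems(3)[folded v] t]) blast
    have len: "length r = \<delta> i" using structure_length[OF D r(1)] .
    let ?u = "map (\<lambda>l. if l = j then h k (r ! l) (s ! l) else h (Suc k) (r ! l) (s ! l)) [0..<length r]"
    have "?u \<in> rel D i"
      using step t(1) r(1) s(1) t(3)[folded len] unfolding link_step_def by (elim conjE) simp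
    moreover have "?u ! l \<in> surviving I \<delta> D A (Suc p) (t ! l)" if "l < \<delta> i" "l \<noteq> j" for l
      using that len Suc.IH[OF _ r(3) s(3)] Suc.prems(1) k(2) by simp
    moreover have "?u ! j = h k a b" using t(3) len r(2) s(2) by simp
    ultimately show "\<exists>s\<in>rel D i. s ! j = h k a b \<and> (\<forall>l<\<delta> i. l \<noteq> j \<longrightarrow> s ! l \<in> surviving I \<delta> D A (Suc p) (t ! l))"
      by blast
  qed
  then show ?case by (simp only: k_def)
qed

text \<open>If nothing dies out in \<open>n + 1\<close> rounds, then round \<open>n + 2\<close> deletes nothing: apply
  \<open>linked_surviving\<close> with \<open>p = n\<close>, where \<open>h\<^sub>0\<close> returns the value that had survived only \<open>n\<close> rounds.\<close>

lemma linked_arc_consistent: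
  assumes D: "is_structure I \<delta> D" and A: "is_structure I \<delta> A"
    and link: "linked_projections I D n h"
    and nonempty: "\<And>v. v \<in> base A \<Longrightarrow> surviving I \<delta> D A (Suc n) v \<noteq> {}"
  shows "hom_to I A (power_structure I \<delta> D)"
proof -
  let ?L = "surviving I \<delta> D A (Suc n)"
  have "\<exists>s\<in>rel D i. s ! j = d \<and> (\<forall>l<\<delta> i. s ! l \<in> ?L (t ! l))"
    if t: "i \<in> I" "t \<in> rel A i" "j < \<delta> i" and d: "d \<in> ?L (t ! j)" for i t j d
  proof -
    obtain s where s: "s \<in> rel D i" "s ! j = d"
      "\<And>l. l < \<delta> i \<Longrightarrow> l \<noteq> j \<Longrightarrow> s ! l \<in> surviving I \<delta> D A n (t ! l)"
      by (rule survivingE[OF d t]) blast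
    have "s ! l \<in> ?L (t ! l)" if l: "l < \<delta> i" for l
    proof (cases "l = j")
      case True
      then show ?thesis using s d by simp
    next
      case False
      obtain b where b: "b \<in> ?L (t ! l)" using nonempty structure_nth[OF A t(2) l] by blast
      have "h (n - n) (s ! l) b \<in> ?L (t ! l)"
        using linked_surviving[OF D A link le_refl s(3)[OF l False] b] .
      moreover have "h 0 (s ! l) b = s ! l"
        using link structure_nth[OF D s(1) l] subsetD[OF surviving_base b] by (simp add: linked_projections_def)
      ultimately show ?thesis by simp
    qed
    then show ?thesis using s by blast
  qed
  note consistent = this
  have "is_hom I A (power_structure I \<delta> D) ?L"
    unfolding is_hom_def
  proof (intro conjI ballI)
    show "?L ` base A \<subseteq> base (power_structure I \<delta> D)"
      using nonempty surviving_base[of I \<delta> D A "Suc n"]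
      by (simp add: power_structure_def image_subset_iff del: surviving.simps)
    fix i t assume t: "i \<in> I" "t \<in> rel A i"
    have len: "length t = \<delta> i" using structure_length[OF A t(2)] .
    have "set (map ?L t) \<subseteq> {S. S \<noteq> {} \<and> S \<subseteq> base D}"
      using nonempty surviving_base[of I \<delta> D A "Suc n"] structure_entries[OF A t(2)]
      by (auto simp: subset_iff simp del: surviving.simps)
    moreover have "\<forall>j<\<delta> i. \<forall>d\<in>map ?L t ! j. \<exists>s\<in>rel D i. s ! j = d \<and> (\<forall>l<\<delta> i. s ! l \<in> map ?L t ! l)"
      using consistent[OF t] len by (simp del: surviving.simps)
    ultimately show "map ?L t \<in> rel (power_structure I \<delta> D) i"
      using t len by (simp add: power_structure_def del: surviving.simps)
  qed
  then show ?thesis unfolding hom_to_def by blast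
qed

primrec support_bound :: "nat \<Rightarrow> nat \<Rightarrow> nat \<Rightarrow> nat" where
  "support_bound m r 0 = 1"
| "support_bound m r (Suc k) = 1 + m * (r + r * support_bound m r k)"

text \<open>Every value outside the list of \<open>v\<close> has been deleted because of one tuple; collecting these tuples and,
  recursively, the supports of their elements, gives a set whose size depends only on \<open>D\<close>, the arities and \<open>k\<close>.\<close>

lemma surviving_support:
  assumes D: "is_structure I \<delta> D" and A: "is_structure I \<delta> A" and r: "\<And>i. i \<in> I \<Longrightarrow> \<delta> i \<le> r"
  shows "v \<in> base A \<Longrightarrow> \<exists>S\<subseteq>base A. v \<in> S \<and> card S \<le> support_bound (card (base D)) r k \<and>
    (\<forall>T. S \<subseteq> T \<longrightarrow> surviving I \<delta> D (induced A T) k v \<subseteq> surviving I \<delta> D A k v)"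
proof (induction k arbitrary: v)
  case 0
  then show ?case by (intro exI[of _ "{v}"]) auto
next
  case (Suc k)
  let ?b = "support_bound (card (base D)) r k"
  obtain S where S: "\<And>v. v \<in> base A \<Longrightarrow> S v \<subseteq> base A" "\<And>v. v \<in> base A \<Longrightarrow> v \<in> S v"
    "\<And>v. v \<in> base A \<Longrightarrow> card (S v) \<le> ?b"
    "\<And>v T. v \<in> base A \<Longrightarrow> S v \<subseteq> T \<Longrightarrow> surviving I \<delta> D (induced A T) k v \<subseteq> surviving I \<delta> D A k v"
    using Suc.IH by metis
  have finS: "finite (S v)" if "v \<in> base A" for v
    using S(1)[OF that] structure_finite[OF A] finite_subset by blast
  have "\<exists>W\<subseteq>base A. card W \<le> r + r * ?b \<and>
      (\<forall>T. v \<in> T \<and> W \<subseteq> T \<longrightarrow> d \<notin> surviving I \<delta> D (induced A T) (Suc k) v)"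
    if d: "d \<in> base D" "d \<notin> surviving I \<delta> D A (Suc k) v" for d
  proof -
    obtain i t j where t: "i \<in> I" "t \<in> rel A i" "j < \<delta> i" "t ! j = v"
      and bad: "\<And>s. s \<in> rel D i \<Longrightarrow> s ! j = d \<Longrightarrow> \<exists>l<\<delta> i. l \<noteq> j \<and> s ! l \<notin> surviving I \<delta> D A k (t ! l)"
      using d by auto
    have tA: "set t \<subseteq> base A" using structure_entries[OF A t(2)] .
    have len: "length t = \<delta> i" using structure_length[OF A t(2)] .
    define W where "W = (\<Union>x\<in>set t. S x)"
    have "card W \<le> (\<Sum>x\<in>set t. card (S x))" unfolding W_def by (rule card_UN_le) simp
    also have "\<dots> \<le> (\<Sum>x\<in>set t. ?b)" using S(3) tA by (intro sum_mono) blast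
    also have "\<dots> \<le> r * ?b"
      using card_length[of t] r[OF t(1)] len by simp
    finally have card: "card W \<le> r + r * ?b" by simp
    have "d \<notin> surviving I \<delta> D (induced A T) (Suc k) v" if T: "W \<subseteq> T" for T
    proof
      assume dT: "d \<in> surviving I \<delta> D (induced A T) (Suc k) v"
      have "set t \<subseteq> T" using T tA S(2) unfolding W_def by blast
      then have tT: "t \<in> rel (induced A T) i" using t(2) by simp
      obtain s where s: "s \<in> rel D i" "s ! j = d"
        "\<And>l. l < \<delta> i \<Longrightarrow> l \<noteq> j \<Longrightarrow> s ! l \<in> surviving I \<delta> D (induced A T) k (t ! l)"
        by (rule survivingE[OF dT[folded t(4)] t(1) tT t(3)]) blast
      have "s ! l \<in> surviving I \<delta> D A k (t ! l)" if l: "l < \<delta> i" "l \<noteq> j" for l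
      proof -
        have "t ! l \<in> set t" using l(1) len by simp
        then have "S (t ! l) \<subseteq> T" "t ! l \<in> base A" using T tA unfolding W_def by blast+
        then show ?thesis using S(4) s(3)[OF l] by blast
      qed
      then show False using bad[OF s(1,2)] by blast
    qed
    moreover have "W \<subseteq> base A" using S(1) tA unfolding W_def by blast
    ultimately show ?thesis using card by blast
  qed
  then obtain W where W: "\<And>d. d \<in> base D - surviving I \<delta> D A (Suc k) v \<Longrightarrow> W d \<subseteq> base A"
    "\<And>d. d \<in> base D - surviving I \<delta> D A (Suc k) v \<Longrightarrow> card (W d) \<le> r + r * ?b"
    "\<And>d T. d \<in> base D - surviving I \<delta> D A (Suc k) v \<Longrightarrow> v \<in> T \<Longrightarrow> W d \<subseteq> T \<Longrightarrow>
       d \<notin> surviving I \<delta> D (induced A T) (Suc k) v"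
    by (metis DiffE)
  let ?R = "base D - surviving I \<delta> D A (Suc k) v"
  let ?S = "insert v (\<Union>d\<in>?R. W d)"
  have finR: "finite ?R" using structure_finite[OF D] by simp
  have "card (\<Union>d\<in>?R. W d) \<le> (\<Sum>d\<in>?R. card (W d))" by (rule card_UN_le[OF finR])
  also have "\<dots> \<le> (\<Sum>d\<in>?R. r + r * ?b)" using W(2) by (rule sum_mono)
  also have "\<dots> \<le> card (base D) * (r + r * ?b)"
    using card_mono[OF structure_finite[OF D], of ?R] by (simp only: sum_constant of_nat_id) (intro mult_le_mono1, blast)
  finally have "card ?S \<le> support_bound (card (base D)) r (Suc k)"
    using card_insert_le_m1[of "Suc (card (base D) * (r + r * ?b))" "\<Union>d\<in>?R. W d" v] by simp
  moreover have "?S \<subseteq> base A" using W(1) Suc.prems by blast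
  moreover have "surviving I \<delta> D (induced A T) (Suc k) v \<subseteq> surviving I \<delta> D A (Suc k) v" if "?S \<subseteq> T" for T
    using W(3) that by (intro subsetI) (metis (no_types, lifting) DiffI UN_subset_iff insert_subset surviving_baseD)
  ultimately show ?case by blast
qed

lemma linked_bounded_obstructions:
  fixes D :: "('i, nat) rstruct"
  assumes type: "is_type I \<delta>" and D: "is_structure I \<delta> D"
    and power: "hom_to I (power_structure I \<delta> D) D" and link: "linked_projections I D n h"
  shows "\<exists>N. bounded_obstructions I \<delta> N D"
proof -
  define r where "r = Max (insert 0 (\<delta> ` I))"
  have r: "\<delta> i \<le> r" if "i \<in> I" for i
    using type that by (auto simp: r_def is_type_def)
  have "bounded_obstructions I \<delta> (support_bound (card (base D)) r (Suc n)) D"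
    unfolding bounded_obstructions_def
  proof (intro allI impI)
    fix A :: "('i, nat) rstruct"
    assume A: "is_structure I \<delta> A" and no: "\<not> hom_to I A D"
    have "\<not> hom_to I A (power_structure I \<delta> D)" using no power hom_to_trans by blast
    then obtain v where v: "v \<in> base A" "surviving I \<delta> D A (Suc n) v = {}"
      using linked_arc_consistent[OF D A link] by blast
    obtain S where S: "S \<subseteq> base A" "v \<in> S" "card S \<le> support_bound (card (base D)) r (Suc n)"
      "\<And>T. S \<subseteq> T \<Longrightarrow> surviving I \<delta> D (induced A T) (Suc n) v \<subseteq> surviving I \<delta> D A (Suc n) v"
      using surviving_support[OF D A r v(1), of "Suc n"] by blast
    have "is_structure I \<delta> (induced A S)" using S(1,2) by (intro induced_structure[OF A]) auto
    then have "f v \<in> surviving I \<delta> D (induced A S) (Suc n) v" if "is_hom I (induced A S) D f" for f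
      using hom_surviving[OF _ that] S(2) by (simp del: surviving.simps)
    then have "\<not> hom_to I (induced A S) D"
      using S(4)[OF subset_refl] v(2) unfolding hom_to_def by blast
    then show "\<exists>S. S \<noteq> {} \<and> S \<subseteq> base A \<and> card S \<le> support_bound (card (base D)) r (Suc n) \<and>
        \<not> hom_to I (induced A S) D"
      using S by blast
  qed
  then show ?thesis by blast
qed

section \<open>Tree duality\<close>

text \<open>The labelling \<open>c\<close> certifies that position \<open>j\<close> of the tuple \<open>e\<close> is a bridge: \<open>c\<close> is constant on the components
  that remain when \<open>e\<close> is removed, and it separates the element at position \<open>j\<close> from the other elements
  of \<open>e\<close>. Labels avoid any talk about paths and cycles.\<close>

definition splits :: "'i set \<Rightarrow> ('i \<Rightarrow> nat) \<Rightarrow> ('i, 'a) rstruct \<Rightarrow> 'i \<Rightarrow> 'a list \<Rightarrow> nat \<Rightarrow> ('a \<Rightarrow> nat) \<Rightarrow> bool" where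
  "splits I \<delta> F i e j c \<longleftrightarrow>
     (\<forall>i'\<in>I. \<forall>t\<in>rel F i'. (i', t) \<noteq> (i, e) \<longrightarrow> (\<forall>l<\<delta> i'. \<forall>l'<\<delta> i'. c (t ! l) = c (t ! l'))) \<and>
     (\<forall>l<\<delta> i. l \<noteq> j \<longrightarrow> c (e ! l) \<noteq> c (e ! j))"

text \<open>Induction over the tuples that are to be preserved, with a prescribed value from its list at one element \<open>x\<close>.
  When the tuple \<open>e\<close> is added, its elements lie in different components of the rest. In the component of \<open>x\<close>
  take the map with the prescribed value at \<open>x\<close>; arc consistency extends its value at \<open>e\<close> to a tuple \<open>s\<close> of \<open>D\<close>, and
  the entries of \<open>s\<close> are prescribed in the other components.\<close>

lemma splits_hom:
  assumes type: "is_type I \<delta>" and D: "is_structure I \<delta> D" and F: "is_structure I \<delta> F"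
    and splits: "\<And>i e j. i \<in> I \<Longrightarrow> e \<in> rel F i \<Longrightarrow> j < \<delta> i \<Longrightarrow> \<exists>c. splits I \<delta> F i e j c"
    and L: "is_hom I F (power_structure I \<delta> D) L"
  shows "hom_to I F D"
proof -
  have L1: "L x \<noteq> {}" "L x \<subseteq> base D" if "x \<in> base F" for x
    using is_hom_base[OF L that] by (simp_all add: power_structure_def)
  have L2: "\<exists>s\<in>rel D i. s ! j = d \<and> (\<forall>l<\<delta> i. s ! l \<in> L (t ! l))"
    if "i \<in> I" "t \<in> rel F i" "j < \<delta> i" "d \<in> L (t ! j)" for i t j d
    using is_hom_rel[OF L that(1,2)] that structure_length[OF F that(2)]
    by (simp add: power_structure_def)
  have main: "\<exists>f. (\<forall>x\<in>base F. f x \<in> L x) \<and> f x = d \<and> (\<forall>(i, t)\<in>E. map f t \<in> rel D i)"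
    if "finite E" "E \<subseteq> Sigma I (rel F)" "x \<in> base F" "d \<in> L x" for E x d
    using that
  proof (induction E arbitrary: x d rule: finite_induct)
    case empty
    have "\<forall>y\<in>base F. \<exists>z. z \<in> L y" using L1(1) by blast
    then obtain f where "\<forall>y\<in>base F. f y \<in> L y" by metis
    then show ?case using empty by (intro exI[of _ "f(x := d)"]) auto
  next
    case (insert p E)
    obtain i e where p: "p = (i, e)" by (cases p)
    have i: "i \<in> I" and e: "e \<in> rel F i" and E: "E \<subseteq> Sigma I (rel F)"
      using insert.prems(1) p by auto
    have len: "length e = \<delta> i" using structure_length[OF F e] .
    have \<delta>: "0 < \<delta> i" using type i by (force simp: is_type_def)
    obtain c where c: "\<And>j. j < \<delta> i \<Longrightarrow> splits I \<delta> F i e j (c j)" using splits[OF i e] by metis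
    define P where "P y = (\<lambda>l. l < \<delta> i \<and> c l y = c l (e ! l))" for y
    have P_const: "P (t ! l) = P (t ! l')"
      if "(i', t) \<in> E" "l < \<delta> i'" "l' < \<delta> i'" for i' t l l'
    proof -
      have "(i', t) \<noteq> (i, e)" using that(1) insert.hyps(2) p by auto
      then have "c j (t ! l) = c j (t ! l')" if "j < \<delta> i" for j
        using c[OF that] E \<open>(i', t) \<in> E\<close> \<open>l < \<delta> i'\<close> \<open>l' < \<delta> i'\<close> unfolding splits_def by blast
      then show ?thesis unfolding P_def by metis
    qed
    have P_e: "P (e ! l) l' \<longleftrightarrow> l' = l" if "l < \<delta> i" for l l'
      using c that unfolding P_def splits_def by metis
    \<comment> \<open>The component of \<open>e\<close> that contains \<open>x\<close>; if there is none, any position will do.\<close>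
    define j0 where "j0 = (if \<exists>j. P x j then SOME j. P x j else 0)"
    have Px: "P x j0" if "P x j" for j unfolding j0_def using that by (metis someI)
    have j0: "j0 < \<delta> i"
    proof (cases "\<exists>j. P x j")
      case True
      then show ?thesis using Px unfolding P_def by blast
    next
      case False
      then show ?thesis using \<delta> by (simp add: j0_def)
    qed
    \<comment> \<open>The component in which \<open>y\<close> is treated. It depends on \<open>y\<close> only through \<open>P y\<close>, so it is constant on the tuples in \<open>E\<close>.\<close>
    define side where "side y = (if P y j0 then j0 else if \<exists>l. P y l then SOME l. P y l else j0)" for y
    have side: "side y < \<delta> i" for y
    proof -
      have "P y (SOME l. P y l)" if "\<exists>l. P y l" using that by (rule someI_ex)
      then show ?thesis using j0 unfolding side_def P_def by auto
    qed
    have side_x: "side x = j0" unfolding side_def using Px by auto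
    have side_e: "side (e ! l) = l" if "l < \<delta> i" for l
      unfolding side_def P_e[OF that] by auto
    obtain f0 where f0: "\<forall>y\<in>base F. f0 y \<in> L y" "f0 x = d" "\<forall>(i, t)\<in>E. map f0 t \<in> rel D i"
      using insert.IH[OF E insert.prems(2,3)] by blast
    have eF: "e ! l \<in> base F" if "l < \<delta> i" for l using structure_nth[OF F e that] .
    obtain s where s: "s \<in> rel D i" "s ! j0 = f0 (e ! j0)" "\<And>l. l < \<delta> i \<Longrightarrow> s ! l \<in> L (e ! l)"
      using L2[OF i e j0] f0(1) eF[OF j0] by blast
    have "\<exists>f. (\<forall>y\<in>base F. f y \<in> L y) \<and> f (e ! l) = s ! l \<and> (\<forall>(i, t)\<in>E. map f t \<in> rel D i)"
      if "l < \<delta> i" for l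
      using insert.IH[OF E eF[OF that] s(3)[OF that]] .
    then obtain g where g: "\<And>l. l < \<delta> i \<Longrightarrow> \<forall>y\<in>base F. g l y \<in> L y"
      "\<And>l. l < \<delta> i \<Longrightarrow> g l (e ! l) = s ! l"
      "\<And>l. l < \<delta> i \<Longrightarrow> \<forall>(i, t)\<in>E. map (g l) t \<in> rel D i" by metis
    define G where "G = g(j0 := f0)"
    have G: "\<forall>y\<in>base F. G l y \<in> L y" "G l (e ! l) = s ! l" "\<forall>(i, t)\<in>E. map (G l) t \<in> rel D i"
      if "l < \<delta> i" for l
      using g[OF that] f0 s(2) by (auto simp: G_def)
    have "map (\<lambda>y. G (side y) y) e = s"
      using len structure_length[OF D s(1)] side_e G(2) by (intro nth_equalityI) auto
    moreover have "map (\<lambda>y. G (side y) y) t \<in> rel D i'" if t: "(i', t) \<in> E" for i' t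
    proof -
      have i': "i' \<in> I" "t \<in> rel F i'" using t E by auto
      then have \<delta>': "0 < \<delta> i'" using type by (force simp: is_type_def)
      have "side y = side (t ! 0)" if y: "y \<in> set t" for y
      proof -
        obtain l where "l < \<delta> i'" "y = t ! l"
          using y structure_length[OF F i'(2)] by (metis in_set_conv_nth)
        then have "P y = P (t ! 0)" using P_const[OF t _ \<delta>'] by blast
        then show ?thesis unfolding side_def by (simp only:)
      qed
      then have "map (\<lambda>y. G (side y) y) t = map (G (side (t ! 0))) t" by simp
      moreover have "map (G (side (t ! 0))) t \<in> rel D i'" using G(3)[OF side] t by blast
      ultimately show ?thesis by (simp only:)
    qed
    ultimately show ?case
      using G(1)[OF side] side_x s(1) p f0(2)
      by (intro exI[of _ "\<lambda>y. G (side y) y"]) (auto simp: G_def)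
  qed
  have fin: "finite (Sigma I (rel F))"
    using type finite_rel[OF F] by (auto simp: is_type_def)
  obtain x where x: "x \<in> base F" using structure_nonempty[OF F] by blast
  then obtain d where d: "d \<in> L x" using L1(1) by blast
  obtain f where f: "\<forall>x\<in>base F. f x \<in> L x" "\<forall>(i, t)\<in>Sigma I (rel F). map f t \<in> rel D i"
    using main[OF fin subset_refl x d] by blast
  then have "f y \<in> base D" if "y \<in> base F" for y using L1(2)[OF that] that by blast
  then have "is_hom I F D f" using f(2) by (auto simp: is_hom_def)
  then show ?thesis unfolding hom_to_def by blast
qed

text \<open>Take \<open>n\<close> copies of \<open>F\<close> without \<open>e\<close>, and for \<open>a < b\<close> let a copy of \<open>e\<close> have its position \<open>j\<close> in copy \<open>b\<close> and the
  others in copy \<open>a\<close>. Let \<open>n\<close> exceed the number of maps from \<open>F\<close> to \<open>D\<close>. A homomorphism from this structure \<open>W\<close> to \<open>D\<close>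
  would agree on two copies \<open>a < b\<close> and give a homomorphism from \<open>F\<close> to \<open>D\<close>. So some member of \<open>\<F>\<close> maps to \<open>W\<close>
  and by projection to \<open>F\<close>; by incomparability it is \<open>F\<close> itself. As \<open>F\<close> is a core, the map from \<open>F\<close> to \<open>W\<close> can be
  normalised to a section of the projection, and the number of the copy is the labelling.\<close>

lemma duality_splits:
  fixes \<F> :: "('i, nat) rstruct set"
  assumes dual: "finite_duality I \<delta> \<F> {D}" and F: "F \<in> \<F>"
    and i: "i \<in> I" and e: "e \<in> rel F i" and j: "j < \<delta> i"
  shows "\<exists>c. splits I \<delta> F i e j c"
proof -
  have strF: "is_structure I \<delta> F" and coreF: "is_core I F" and strD: "is_structure I \<delta> D"
    using dual F by (auto simp: finite_duality_def)
  have lene: "length e = \<delta> i" using structure_length[OF strF e] .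
  have noF: "\<not> hom_to I F D" using finite_dualityD[OF dual strF] F hom_to_refl by blast
  define V where "V = sorted_list_of_set (base F)"
  have V: "set V = base F" unfolding V_def using structure_finite[OF strF] by simp
  define X where "X = {xs. set xs \<subseteq> base D \<and> length xs = length V}"
  have finX: "finite X" unfolding X_def by (rule finite_lists_length_eq[OF structure_finite[OF strD]])
  define n where "n = Suc (card X)"
  define across where "across a b = map (\<lambda>l. (e ! l, if l = j then b else a)) [0..<\<delta> i]" for a b :: nat
  define W where "W = RStruct (base F \<times> {..<n})
     (\<lambda>i'. {map (\<lambda>x. (x, k)) t |t k. t \<in> rel F i' \<and> k < n \<and> (i', t) \<noteq> (i, e)} \<union>
        {across a b |a b. i' = i \<and> a < b \<and> b < n})"
  have strW: "is_structure I \<delta> W"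
    unfolding is_structure_def
  proof (intro conjI ballI allI impI)
    show "finite (base W)" "base W \<noteq> {}"
      using structure_finite[OF strF] structure_nonempty[OF strF] by (auto simp: W_def n_def)
    show "rel W i' = {}" if "i' \<notin> I" for i'
      using structure_index[OF strF] that i by (auto simp: W_def)
    show "rel W i' \<subseteq> {t. length t = \<delta> i' \<and> set t \<subseteq> base W}" if "i' \<in> I" for i'
      using structure_length[OF strF] structure_entries[OF strF] structure_nth[OF strF e]
      by (auto simp: W_def across_def subset_iff)
  qed
  have "\<not> hom_to I W D"
  proof
    assume "hom_to I W D"
    then obtain g where g: "is_hom I W D g" unfolding hom_to_def by blast
    define col where "col k = map (\<lambda>x. g (x, k)) V" for k
    have "col ` {..<n} \<subseteq> X"
      using is_hom_base[OF g] V by (auto simp: X_def col_def W_def)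
    then have "card (col ` {..<n}) < card {..<n}"
      using card_mono[OF finX] by (simp add: n_def le_imp_less_Suc)
    then have "\<not> inj_on col {..<n}" by (rule pigeonhole)
    then obtain a b where ab: "a < b" "b < n" "col a = col b"
      unfolding inj_on_def by (metis lessThan_iff nat_neq_iff)
    then have eq: "g (x, a) = g (x, b)" if "x \<in> base F" for x
      using that V unfolding col_def by auto
    have "is_hom I F D (\<lambda>x. g (x, a))"
      unfolding is_hom_def
    proof (intro conjI ballI)
      show "(\<lambda>x. g (x, a)) ` base F \<subseteq> base D"
        using is_hom_base[OF g] ab by (auto simp: W_def)
      fix i' t assume i': "i' \<in> I" and t: "t \<in> rel F i'"
      show "map (\<lambda>x. g (x, a)) t \<in> rel D i'"
      proof (cases "(i', t) = (i, e)")
        case True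
        have "across a b \<in> rel W i" using ab by (auto simp: W_def)
        then have "map g (across a b) \<in> rel D i" by (rule is_hom_rel[OF g i])
        moreover have "map g (across a b) = map (\<lambda>x. g (x, a)) e"
          using lene eq structure_nth[OF strF e] by (intro nth_equalityI) (auto simp: across_def)
        ultimately show ?thesis using True by simp
      next
        case False
        moreover have "a < n" using ab by simp
        ultimately have "map (\<lambda>x. (x, a)) t \<in> rel W i'"
          using t unfolding W_def rstruct.sel by blast
        then have "map g (map (\<lambda>x. (x, a)) t) \<in> rel D i'" by (rule is_hom_rel[OF g i'])
        then show ?thesis by (simp add: comp_def)
      qed
    qed
    then show False using noF unfolding hom_to_def by blast
  qed
  then obtain F' where F': "F' \<in> \<F>" "hom_to I F' W"
    using finite_dualityD[OF dual strW] by blast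
  have fst: "map fst t \<in> rel F i'" if "t \<in> rel W i'" for t i'
    using that e lene by (auto simp: W_def across_def comp_def) (metis map_nth)
  have proj: "is_hom I W F fst"
    unfolding is_hom_def using fst by (auto simp: W_def)
  then have "hom_to I F' F" using F'(2) hom_to_trans unfolding hom_to_def by blast
  then have "F' = F" using dual F F'(1) by (auto simp: finite_duality_def incomparable_def)
  then obtain \<phi> where \<phi>: "is_hom I F W \<phi>" using F'(2) unfolding hom_to_def by blast
  obtain r where r: "is_hom I F F r" "\<And>x. x \<in> base F \<Longrightarrow> r ((fst \<circ> \<phi>) x) = x"
    "\<And>x. x \<in> base F \<Longrightarrow> (fst \<circ> \<phi>) (r x) = x"
    by (rule core_endo_inverse[OF strF coreF is_hom_comp[OF \<phi> proj]]) blast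
  define \<psi> where "\<psi> = \<phi> \<circ> r"
  have \<psi>: "is_hom I F W \<psi>" unfolding \<psi>_def by (rule is_hom_comp[OF r(1) \<phi>])
  have lift: "map fst (map \<psi> t) = t" if "t \<in> rel F i'" for t i'
    using r(3) structure_entries[OF strF that] unfolding \<psi>_def by (auto simp: map_idI subset_iff)
  have "splits I \<delta> F i e j (snd \<circ> \<psi>)"
    unfolding splits_def
  proof (intro conjI ballI allI impI)
    fix i' t l l' assume i': "i' \<in> I" and t: "t \<in> rel F i'" and ne: "(i', t) \<noteq> (i, e)"
      and l: "l < \<delta> i'" "l' < \<delta> i'"
    have len: "length t = \<delta> i'" using structure_length[OF strF t] .
    have "map \<psi> t \<in> rel W i'" by (rule is_hom_rel[OF \<psi> i' t])
    then consider s k where "map \<psi> t = map (\<lambda>x. (x, k)) s" | a b where "i' = i" "map \<psi> t = across a b"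
      by (auto simp: W_def)
    then show "(snd \<circ> \<psi>) (t ! l) = (snd \<circ> \<psi>) (t ! l')"
    proof cases
      case (1 s k)
      have "length s = length t" using 1 by (metis length_map)
      then have "\<psi> (t ! m) = (s ! m, k)" if "m < \<delta> i'" for m
        using arg_cong[OF 1, of "\<lambda>u. u ! m"] that len by simp
      then show ?thesis using l by simp
    next
      case (2 a b)
      have "t = map fst (across a b)" using lift[OF t] 2 by simp
      also have "\<dots> = e" using lene by (intro nth_equalityI) (auto simp: across_def)
      finally show ?thesis using ne 2 by simp
    qed
  next
    fix l assume l: "l < \<delta> i" "l \<noteq> j"
    have "map \<psi> e \<in> rel W i" by (rule is_hom_rel[OF \<psi> i e])
    then consider s k where "map \<psi> e = map (\<lambda>x. (x, k)) s" "s \<noteq> e" | a b where "map \<psi> e = across a b" "a < b"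
      by (auto simp: W_def)
    then show "(snd \<circ> \<psi>) (e ! l) \<noteq> (snd \<circ> \<psi>) (e ! j)"
    proof cases
      case (1 s k)
      have "e = map fst (map (\<lambda>x. (x, k)) s)" using lift[OF e] 1(1) by simp
      then show ?thesis using 1(2) by (simp add: comp_def)
    next
      case (2 a b)
      have "\<psi> (e ! m) = (e ! m, if m = j then b else a)" if "m < \<delta> i" for m
        using arg_cong[OF 2(1), of "\<lambda>u. u ! m"] that lene by (simp add: across_def)
      then show ?thesis using l j 2(2) by simp
    qed
  qed
  then show ?thesis by blast
qed

lemma duality_power_structure:
  fixes \<F> :: "('i, nat) rstruct set"
  assumes type: "is_type I \<delta>" and dual: "finite_duality I \<delta> \<F> {D}"
  shows "hom_to I (power_structure I \<delta> D) D"
proof (rule ccontr)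
  assume no: "\<not> hom_to I (power_structure I \<delta> D) D"
  have D: "is_structure I \<delta> D" using dual by (simp add: finite_duality_def)
  obtain F where F: "F \<in> \<F>" and hom: "hom_to I F (power_structure I \<delta> D)"
    using finite_dualityD[OF dual power_structure_structure[OF D]] no by blast
  obtain L where L: "is_hom I F (power_structure I \<delta> D) L" using hom unfolding hom_to_def by blast
  have strF: "is_structure I \<delta> F" using dual F by (simp add: finite_duality_def)
  have "hom_to I F D"
    by (rule splits_hom[OF type D strF duality_splits[OF dual F] L])
  moreover have "\<not> hom_to I F D" using finite_dualityD[OF dual strF] F hom_to_refl by blast
  ultimately show False by blast
qed

lemma duality_criterion:
  fixes \<D> :: "('i, nat) rstruct set"
  assumes type: "is_type I \<delta>" and \<D>: "structure_family I \<delta> \<D>"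
  shows "(\<exists>\<F>. finite_duality I \<delta> \<F> \<D>) \<longleftrightarrow>
    (\<forall>D\<in>\<D>. is_core I D \<and> hom_to I (power_structure I \<delta> D) D \<and> (\<exists>n h. linked_projections I D n h)) \<and>
    (\<forall>D\<in>\<D>. \<forall>D'\<in>\<D>. D \<noteq> D' \<longrightarrow> \<not> hom_to I D D')"
    (is "?dual \<longleftrightarrow> ?crit")
proof -
  have str: "is_structure I \<delta> D" if "D \<in> \<D>" for D using \<D> that by (simp add: structure_family_def)
  have ?crit if dual: ?dual
  proof -
    obtain \<F> where dual: "finite_duality I \<delta> \<F> \<D>" using dual by blast
    have core: "is_core I D" if "D \<in> \<D>" for D using dual that by (simp add: finite_duality_def)
    have anti: "\<not> hom_to I D D'" if "D \<in> \<D>" "D' \<in> \<D>" "D \<noteq> D'" for D D'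
      using dual that by (simp add: finite_duality_def incomparable_def)
    have "hom_to I (power_structure I \<delta> D) D \<and> (\<exists>n h. linked_projections I D n h)" if D: "D \<in> \<D>" for D
    proof -
      obtain N where bo: "bounded_obstructions I \<delta> N D"
        using duality_bounded_obstructions[OF type dual D] by blast
      have "\<exists>\<F>. finite_duality I \<delta> \<F> {D}"
        using bounded_obstructions_duality[OF type, of "{D}"] str[OF D] core[OF D] bo by auto
      then show ?thesis
        using duality_power_structure[OF type] bounded_obstructions_linked[OF str[OF D] core[OF D] bo] by blast
    qed
    then show ?thesis using core anti by blast
  qed
  moreover have ?dual if ?crit
  proof (rule bounded_obstructions_duality[OF type])
    show "finite \<D>" using \<D> by (simp add: structure_family_def)
    show "\<exists>N. bounded_obstructions I \<delta> N D" if "D \<in> \<D>" for D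
      using linked_bounded_obstructions[OF type str[OF that]] \<open>?crit\<close> that by blast
  qed (use str \<open>?crit\<close> in \<open>auto simp: incomparable_def\<close>)
  ultimately show ?thesis by blast
qed

section \<open>A calculus of recursive functions\<close>

text \<open>The environment of a formula is the argument list: a quantifier pushes its variable in front, so the bound
  variables read \<open>hd xs\<close>, \<open>hd (tl xs)\<close> and so on. The closure rules below have the shape of the
  syntax, so that recursiveness of a bounded formula is proved by applying them repeatedly.\<close>

definition recursive_pred :: "nat \<Rightarrow> (nat list \<Rightarrow> bool) \<Rightarrow> bool" where
  "recursive_pred n P \<longleftrightarrow> recursive n (\<lambda>xs. of_bool (P xs))"

lemma rec_map:
  assumes "recursive (length hs) g" "\<And>h. h \<in> set hs \<Longrightarrow> recursive n h"
    "\<And>xs. length xs = n \<Longrightarrow> f xs = g (map (\<lambda>h. h xs) hs)"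
  shows "recursive n f"
  using recursive.ext[OF recursive.comp[OF assms(1)]] assms(2,3) by blast

lemma rec_comp1: "recursive 1 (\<lambda>ys. g (hd ys)) \<Longrightarrow> recursive n f \<Longrightarrow> recursive n (\<lambda>xs. g (f xs))"
  by (rule rec_map[of "[f]" "\<lambda>ys. g (hd ys)"]) auto

lemma rec_var: "recursive (Suc n) (\<lambda>xs. hd xs)"
  by (rule recursive.ext[OF recursive.proj[of 0]]) (auto simp: hd_conv_nth simp flip: length_greater_0_conv)

lemma rec_weaken: "recursive n f \<Longrightarrow> recursive (Suc n) (\<lambda>xs. f (tl xs))"
  by (rule rec_map[of "map (\<lambda>i xs. xs ! Suc i) [0..<n]" f])
    (auto intro!: recursive.proj arg_cong[of _ _ f] nth_equalityI simp: nth_tl)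

lemma rec_cons:
  assumes "recursive (Suc n) f" "recursive n k"
  shows "recursive n (\<lambda>xs. f (k xs # xs))"
proof (rule rec_map[of "k # map (\<lambda>i xs. xs ! i) [0..<n]" f])
  show "f (k xs # xs) = f (map (\<lambda>h. h xs) (k # map (\<lambda>i xs. xs ! i) [0..<n]))" if "length xs = n" for xs
    using that by (auto intro!: arg_cong[of _ _ f] nth_equalityI)
qed (use assms in \<open>auto intro!: recursive.proj\<close>)

lemma rec_Suc: "recursive n f \<Longrightarrow> recursive n (\<lambda>xs. Suc (f xs))"
  by (rule rec_comp1[OF recursive.succ])

lemma rec_const: "recursive n (\<lambda>xs. c)"
  by (induction c) (auto intro: recursive.zero rec_Suc)

lemma rec_rec_nat:
  assumes "recursive n k" "recursive n g" "recursive (Suc (Suc n)) (\<lambda>zs. h (hd zs) (hd (tl zs)) (tl (tl zs)))"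
  shows "recursive n (\<lambda>xs. rec_nat (g xs) (\<lambda>i r. h i r xs) (k xs))"
  using rec_cons[OF recursive.prim[OF assms(2,3)] assms(1)] by simp

lemma rec_weaken2: "recursive n f \<Longrightarrow> recursive (Suc (Suc n)) (\<lambda>xs. f (tl (tl xs)))"
  using rec_weaken[OF rec_weaken] by blast

lemma rec_add:
  assumes "recursive n f" "recursive n g"
  shows "recursive n (\<lambda>xs. f xs + g xs)"
proof -
  have "rec_nat a (\<lambda>i r. Suc r) b = a + b" for a b :: nat by (induction b) auto
  then show ?thesis
    using rec_rec_nat[OF assms(2,1), of "\<lambda>i r xs. Suc r"] rec_Suc[OF rec_weaken[OF rec_var]] by simp
qed

lemma rec_mult:
  assumes "recursive n f" "recursive n g"
  shows "recursive n (\<lambda>xs. f xs * g xs)"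
proof -
  have "rec_nat 0 (\<lambda>i r. r + a) b = a * b" for a b :: nat by (induction b) auto
  then show ?thesis
    using rec_rec_nat[OF assms(2) rec_const[of _ 0], of "\<lambda>i r xs. r + f xs"]
      rec_add[OF rec_weaken[OF rec_var] rec_weaken2[OF assms(1)]] by simp
qed

lemma rec_power:
  assumes "recursive n f" "recursive n g"
  shows "recursive n (\<lambda>xs. f xs ^ g xs)"
proof -
  have "rec_nat 1 (\<lambda>i r. r * a) b = a ^ b" for a b :: nat by (induction b) auto
  then show ?thesis
    using rec_rec_nat[OF assms(2) rec_const[of _ 1], of "\<lambda>i r xs. r * f xs"]
      rec_mult[OF rec_weaken[OF rec_var] rec_weaken2[OF assms(1)]] by simp
qed

lemma rec_minus_one:
  assumes "recursive n f"
  shows "recursive n (\<lambda>xs. f xs - 1)"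
proof -
  have "rec_nat 0 (\<lambda>i r. i) b = b - 1" for b :: nat by (induction b) auto
  then show ?thesis
    using rec_rec_nat[OF assms rec_const[of _ 0], of "\<lambda>i r xs. i"] rec_var by simp
qed

lemma rec_diff:
  assumes "recursive n f" "recursive n g"
  shows "recursive n (\<lambda>xs. f xs - g xs)"
proof -
  have "rec_nat a (\<lambda>i r. r - 1) b = a - b" for a b :: nat by (induction b) auto
  then show ?thesis
    using rec_rec_nat[OF assms(2,1), of "\<lambda>i r xs. r - 1"] rec_minus_one[OF rec_weaken[OF rec_var]] by simp
qed

lemma pred_const: "recursive_pred n (\<lambda>xs. c)"
  unfolding recursive_pred_def by (rule rec_const)

lemma pred_not:
  assumes "recursive_pred n P" shows "recursive_pred n (\<lambda>xs. \<not> P xs)"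
proof -
  have "of_bool (\<not> p) = (1 :: nat) - of_bool p" for p by simp
  then show ?thesis
    unfolding recursive_pred_def using rec_diff[OF rec_const[of _ 1] assms[unfolded recursive_pred_def]]
    by (simp only:)
qed

lemma pred_conj:
  assumes "recursive_pred n P" "recursive_pred n Q" shows "recursive_pred n (\<lambda>xs. P xs \<and> Q xs)"
  using rec_mult[OF assms[unfolded recursive_pred_def]] unfolding recursive_pred_def of_bool_conj .

lemma pred_disj:
  assumes "recursive_pred n P" "recursive_pred n Q" shows "recursive_pred n (\<lambda>xs. P xs \<or> Q xs)"
  using pred_not[OF pred_conj[OF assms[THEN pred_not]]] by simp

lemma pred_imp:
  assumes "recursive_pred n P" "recursive_pred n Q" shows "recursive_pred n (\<lambda>xs. P xs \<longrightarrow> Q xs)"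
  using pred_disj[OF pred_not[OF assms(1)] assms(2)] by (simp only: imp_conv_disj)

lemma pred_le:
  assumes "recursive n f" "recursive n g" shows "recursive_pred n (\<lambda>xs. f xs \<le> g xs)"
proof -
  have "of_bool (a \<le> b) = 1 - (a - b)" for a b :: nat by simp
  then show ?thesis
    unfolding recursive_pred_def using rec_diff[OF rec_const[of _ 1] rec_diff[OF assms]] by simp
qed

lemma pred_less:
  assumes "recursive n f" "recursive n g" shows "recursive_pred n (\<lambda>xs. f xs < g xs)"
  using pred_le[OF rec_Suc[OF assms(1)] assms(2)] by (simp add: Suc_le_eq)

lemma pred_eq:
  assumes "recursive n f" "recursive n g" shows "recursive_pred n (\<lambda>xs. f xs = g xs)"
  using pred_conj[OF pred_le[OF assms] pred_le[OF assms(2,1)]] by (simp add: order_eq_iff)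

lemma rec_if:
  assumes "recursive_pred n P" "recursive n f" "recursive n g"
  shows "recursive n (\<lambda>xs. if P xs then f xs else g xs)"
proof -
  have "(if p then a else b) = of_bool p * a + of_bool (\<not> p) * b" for p and a b :: nat by simp
  then show ?thesis
    using rec_add[OF rec_mult[OF assms(1)[unfolded recursive_pred_def] assms(2)]
        rec_mult[OF pred_not[OF assms(1), unfolded recursive_pred_def] assms(3)]] by simp
qed

lemma rec_weaken_second:
  "recursive (Suc n) f \<Longrightarrow> recursive (Suc (Suc n)) (\<lambda>zs. f (hd zs # tl (tl zs)))"
  by (rule rec_map[of "(\<lambda>xs. xs ! 0) # map (\<lambda>i xs. xs ! Suc (Suc i)) [0..<n]" f])
    (auto intro!: recursive.proj arg_cong[of _ _ f] nth_equalityI simp: nth_tl hd_conv_nth simp flip: length_greater_0_conv)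

lemma pred_ex:
  assumes "recursive n b" "recursive_pred (Suc n) (\<lambda>ys. P (hd ys) (tl ys))"
  shows "recursive_pred n (\<lambda>xs. \<exists>y<b xs. P y xs)"
proof -
  have eq: "rec_nat 0 (\<lambda>i r. of_bool (r = (1::nat) \<or> Q i)) m = of_bool (\<exists>y<m. Q y)" for m Q
    by (induction m) (auto simp: less_Suc_eq)
  have "recursive_pred (Suc (Suc n)) (\<lambda>zs. P (hd zs) (tl (tl zs)))"
    using rec_weaken_second[OF assms(2)[unfolded recursive_pred_def]] unfolding recursive_pred_def by simp
  then have "recursive_pred (Suc (Suc n)) (\<lambda>zs. hd (tl zs) = 1 \<or> P (hd zs) (tl (tl zs)))"
    by (intro pred_disj pred_eq rec_const rec_weaken rec_var)
  from rec_rec_nat[OF assms(1) rec_const[of n 0], of "\<lambda>i r xs. of_bool (r = 1 \<or> P i xs)",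
      OF this[unfolded recursive_pred_def]]
  show ?thesis unfolding recursive_pred_def eq .
qed

lemma pred_all:
  assumes "recursive n b" "recursive_pred (Suc n) (\<lambda>ys. P (hd ys) (tl ys))"
  shows "recursive_pred n (\<lambda>xs. \<forall>y<b xs. P y xs)"
  using pred_not[OF pred_ex[OF assms(1) pred_not[OF assms(2)]]] by simp

lemma pred_ball:
  assumes "finite A" "\<And>a. a \<in> A \<Longrightarrow> recursive_pred n (P a)"
  shows "recursive_pred n (\<lambda>xs. \<forall>a\<in>A. P a xs)"
  using assms by (induction A rule: finite_induct) (auto intro: pred_const pred_conj)

lemma rec_Least:
  assumes "recursive_pred (Suc n) (\<lambda>ys. P (hd ys) (tl ys))" "\<And>xs. \<exists>y. P y xs"
  shows "recursive n (\<lambda>xs. LEAST y. P y xs)"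
proof -
  let ?f = "\<lambda>ys. of_bool (\<not> P (hd ys) (tl ys)) :: nat"
  have "recursive (Suc n) ?f" using pred_not[OF assms(1)] unfolding recursive_pred_def .
  moreover have "\<forall>xs. length xs = n \<longrightarrow> (\<exists>y. ?f (y # xs) = 0)" using assms(2) by simp
  ultimately have "recursive n (\<lambda>xs. LEAST y. ?f (y # xs) = 0)" by (rule recursive.mini)
  then show ?thesis by simp
qed

text \<open>Multiplying out a quotient bound gives a search that succeeds also for the divisor \<open>0\<close>, where the result is \<open>0\<close>.\<close>

lemma rec_div:
  assumes "recursive n f" "recursive n g" shows "recursive n (\<lambda>xs. f xs div g xs)"
proof -
  have eq: "a div b = (LEAST y. b = 0 \<or> a < Suc y * b)" for a b :: nat
  proof (rule Least_equality[symmetric])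
    show "b = 0 \<or> a < Suc (a div b) * b" using dividend_less_div_times[of b a] by auto
    show "a div b \<le> y" if "b = 0 \<or> a < Suc y * b" for y
      using that by (auto simp: less_mult_imp_div_less less_Suc_eq_le[symmetric])
  qed
  have "\<exists>y. b = 0 \<or> a < Suc y * b" for a b :: nat
    by (rule exI[of _ a]) (cases b; simp)
  then show ?thesis
    unfolding eq
    by (intro rec_Least pred_disj pred_eq pred_less rec_mult rec_Suc rec_var rec_const rec_weaken assms)
qed

lemma rec_mod:
  assumes "recursive n f" "recursive n g" shows "recursive n (\<lambda>xs. f xs mod g xs)"
  using rec_diff[OF assms(1) rec_mult[OF rec_div[OF assms] assms(2)]] by (simp only: minus_div_mult_eq_mod)

lemma rec_prod_encode:
  assumes "recursive n f" "recursive n g" shows "recursive n (\<lambda>xs. prod_encode (f xs, g xs))"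
  unfolding prod_encode_def triangle_def prod.case
  by (intro rec_add rec_div rec_mult rec_Suc rec_const assms)

lemma rec_fst_prod_decode:
  assumes "recursive n f" shows "recursive n (\<lambda>xs. fst (prod_decode (f xs)))"
proof -
  have eq: "fst (prod_decode z) = (LEAST a. \<exists>b<Suc z. prod_encode (a, b) = z)" for z
  proof (rule Least_equality[symmetric])
    have "prod_encode (fst (prod_decode z), snd (prod_decode z)) = z" by simp
    moreover from this have "snd (prod_decode z) \<le> z" by (metis le_prod_encode_2)
    ultimately show "\<exists>b<Suc z. prod_encode (fst (prod_decode z), b) = z" by (auto simp: less_Suc_eq_le)
  qed auto
  have "\<exists>a. \<exists>b<Suc z. prod_encode (a, b) = z" for z
    by (metis le_prod_encode_2 less_Suc_eq_le prod.collapse prod_decode_inverse)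
  then show ?thesis
    unfolding eq by (intro rec_Least pred_ex pred_eq rec_prod_encode rec_Suc rec_var rec_weaken assms)
qed

lemma rec_snd_prod_decode:
  assumes "recursive n f" shows "recursive n (\<lambda>xs. snd (prod_decode (f xs)))"
proof -
  have eq: "snd (prod_decode z) = (LEAST b. prod_encode (fst (prod_decode z), b) = z)" for z
    by (rule Least_equality[symmetric]) (auto, metis order_refl prod_encode_inverse snd_conv)
  have "\<exists>b. prod_encode (fst (prod_decode z), b) = z" for z
    by (metis prod.collapse prod_decode_inverse)
  then show ?thesis
    unfolding eq by (intro rec_Least pred_eq rec_prod_encode rec_fst_prod_decode rec_var rec_weaken assms)
qed

lemma pred_set_decode:
  assumes "recursive n f" "recursive n g" shows "recursive_pred n (\<lambda>xs. f xs \<in> set_decode (g xs))"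
proof -
  have "x \<in> set_decode s \<longleftrightarrow> (s div 2 ^ x) mod 2 = 1" for x s
    by (simp add: set_decode_def odd_iff_mod_2_eq_one)
  then show ?thesis
    by (simp only:) (intro pred_eq rec_mod rec_div rec_power rec_const assms)
qed

text \<open>A nonempty list is coded by the successor of a pair, so its tail is reached by taking the predecessor
  and projecting. As \<open>l\<close> is fixed for the algorithm, plain iteration suffices here.\<close>

definition entry :: "nat \<Rightarrow> nat \<Rightarrow> nat" where
  "entry l t = fst (prod_decode (((\<lambda>c. snd (prod_decode (c - 1))) ^^ l) t - 1))"

lemma entry_list_encode: "l < length xs \<Longrightarrow> entry l (list_encode xs) = xs ! l"
proof (induction xs arbitrary: l)
  case (Cons x xs)
  then show ?case by (cases l) (auto simp: entry_def funpow_Suc_right simp del: funpow.simps)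
qed simp

lemma rec_entry:
  assumes "recursive n f" shows "recursive n (\<lambda>xs. entry l (f xs))"
proof -
  have "recursive n (\<lambda>xs. ((\<lambda>c. snd (prod_decode (c - 1))) ^^ l) (f xs))"
  proof (induction l)
    case (Suc l)
    show ?case unfolding funpow.simps comp_def by (intro rec_snd_prod_decode rec_minus_one Suc)
  qed (simp add: assms)
  then show ?thesis unfolding entry_def by (intro rec_fst_prod_decode rec_minus_one)
qed

lemma rec_list_encode:
  assumes "\<And>l. l \<in> set ls \<Longrightarrow> recursive n (g l)"
  shows "recursive n (\<lambda>xs. list_encode (map (\<lambda>l. g l xs) ls))"
  using assms
proof (induction ls)
  case (Cons a ls)
  show ?case
    unfolding list.map list_encode.simps by (intro rec_Suc rec_prod_encode Cons) simp_all
qed (simp add: rec_const)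

section \<open>Functions coded by digits\<close>

definition digit :: "nat \<Rightarrow> nat \<Rightarrow> nat \<Rightarrow> nat" where
  "digit b c x = (c div b ^ x) mod b"

lemma rec_digit:
  "recursive n b \<Longrightarrow> recursive n c \<Longrightarrow> recursive n x \<Longrightarrow> recursive n (\<lambda>xs. digit (b xs) (c xs) (x xs))"
  unfolding digit_def by (intro rec_mod rec_div rec_power)

lemma digit_less: "0 < b \<Longrightarrow> digit b c x < b"
  by (simp add: digit_def)

text \<open>Functions on \<open>{..<n}\<close> with values below \<open>b\<close> are coded by their values as the digits in base \<open>b\<close>, which bounds the quantifiers
  over such functions by \<open>b ^ n\<close>.\<close>

lemma digits_exist:
  assumes "\<And>x. x < n \<Longrightarrow> f x < b"
  shows "\<exists>c<b ^ n. \<forall>x<n. digit b c x = f x"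
  using assms
proof (induction n)
  case (Suc n)
  then obtain c where c: "c < b ^ n" "\<forall>x<n. digit b c x = f x" by auto
  have fn: "f n < b" using Suc.prems by simp
  let ?c = "c + b ^ n * f n"
  have "?c < b ^ n + b ^ n * f n" using c(1) by simp
  also have "\<dots> = b ^ n * Suc (f n)" by simp
  also have "\<dots> \<le> b ^ n * b" using fn by (intro mult_le_mono2) simp
  finally have "?c < b ^ Suc n" by (simp add: mult.commute)
  moreover have "digit b ?c x = f x" if x: "x < Suc n" for x
  proof (cases "x = n")
    case True
    have "?c div b ^ n = f n" using c(1) fn by simp
    then show ?thesis using True fn by (simp add: digit_def)
  next
    case False
    then have "x < n" using x by simp
    then obtain k where k: "n = Suc (x + k)" using less_iff_Suc_add by blast
    have "?c = c + b ^ x * (b * (b ^ k * f n))" by (simp add: k power_add algebra_simps)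
    moreover have "b ^ x \<noteq> 0" using fn by simp
    ultimately have "?c div b ^ x = c div b ^ x + b * (b ^ k * f n)" by (metis add.commute div_mult_self2)
    then show ?thesis using c(2) \<open>x < n\<close> by (simp add: digit_def)
  qed
  ultimately show ?case by blast
qed simp

section \<open>The decision procedure\<close>

text \<open>In what follows \<open>c\<close> is the code of a structure and \<open>b\<close> exceeds all its elements and tuple codes;
  \<open>ds\<close> lists the arities. Quantifiers over positions and over relation symbols range over fixed finite sets and are
  conjunctions from the point of view of the algorithm. Binary operations on \<open>D\<close> are coded by
  digits at \<open>x * b + y\<close>, and operations on subsets by digits at the codes of the subsets.\<close>

definition base_code :: "nat \<Rightarrow> nat" where
  "base_code c = fst (prod_decode c)"

definition rel_code :: "nat \<Rightarrow> nat \<Rightarrow> nat" where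
  "rel_code k c = entry k (snd (prod_decode c))"

definition hom_code :: "nat list \<Rightarrow> nat \<Rightarrow> nat \<Rightarrow> nat \<Rightarrow> nat \<Rightarrow> bool" where
  "hom_code ds b c c' f \<longleftrightarrow>
     (\<forall>x<b. x \<in> set_decode (base_code c) \<longrightarrow> digit b f x \<in> set_decode (base_code c')) \<and>
     (\<forall>k\<in>{..<length ds}. \<forall>t<b. t \<in> set_decode (rel_code k c) \<longrightarrow>
        list_encode (map (\<lambda>l. digit b f (entry l t)) [0..<ds ! k]) \<in> set_decode (rel_code k c'))"

definition hom_to_code :: "nat list \<Rightarrow> nat \<Rightarrow> nat \<Rightarrow> nat \<Rightarrow> bool" where
  "hom_to_code ds b c c' \<longleftrightarrow> (\<exists>f<b ^ b. hom_code ds b c c' f)"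

definition core_code :: "nat list \<Rightarrow> nat \<Rightarrow> nat \<Rightarrow> bool" where
  "core_code ds b c \<longleftrightarrow> (\<forall>f<b ^ b. hom_code ds b c c f \<longrightarrow>
     (\<forall>x<b. \<forall>y<b. x \<in> set_decode (base_code c) \<and> y \<in> set_decode (base_code c) \<and>
        digit b f x = digit b f y \<longrightarrow> x = y))"

definition consistent_code :: "nat list \<Rightarrow> nat \<Rightarrow> nat \<Rightarrow> nat \<Rightarrow> nat \<Rightarrow> bool" where
  "consistent_code ds b c k u \<longleftrightarrow> (\<forall>j\<in>{..<ds ! k}. digit (2 ^ b) u j \<noteq> 0 \<and>
     (\<forall>d<b. d \<in> set_decode (digit (2 ^ b) u j) \<longrightarrow> d \<in> set_decode (base_code c) \<and>
        (\<exists>t<b. t \<in> set_decode (rel_code k c) \<and> entry j t = d \<and>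
           (\<forall>l\<in>{..<ds ! k}. entry l t \<in> set_decode (digit (2 ^ b) u l)))))"

definition power_code :: "nat list \<Rightarrow> nat \<Rightarrow> nat \<Rightarrow> bool" where
  "power_code ds b c \<longleftrightarrow> (\<exists>f<b ^ (2 ^ b).
     (\<forall>s<2 ^ b. s \<noteq> 0 \<and> (\<forall>x<b. x \<in> set_decode s \<longrightarrow> x \<in> set_decode (base_code c)) \<longrightarrow>
        digit b f s \<in> set_decode (base_code c)) \<and>
     (\<forall>k\<in>{..<length ds}. \<forall>u<(2 ^ b) ^ (ds ! k). consistent_code ds b c k u \<longrightarrow>
        list_encode (map (\<lambda>l. digit b f (digit (2 ^ b) u l)) [0..<ds ! k]) \<in> set_decode (rel_code k c)))"

definition link_step_code :: "nat list \<Rightarrow> nat \<Rightarrow> nat \<Rightarrow> nat \<Rightarrow> nat \<Rightarrow> bool" where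
  "link_step_code ds b c h h' \<longleftrightarrow>
     (\<forall>x<b. \<forall>y<b. x \<in> set_decode (base_code c) \<and> y \<in> set_decode (base_code c) \<longrightarrow>
        digit b h' (x * b + y) \<in> set_decode (base_code c)) \<and>
     (\<forall>k\<in>{..<length ds}. \<forall>s<b. \<forall>t<b. s \<in> set_decode (rel_code k c) \<and> t \<in> set_decode (rel_code k c) \<longrightarrow>
        (\<forall>j\<in>{..<ds ! k}. list_encode (map (\<lambda>l. if l = j then digit b h (entry l s * b + entry l t)
           else digit b h' (entry l s * b + entry l t)) [0..<ds ! k]) \<in> set_decode (rel_code k c)))"

definition projection_code :: "nat \<Rightarrow> nat \<Rightarrow> (nat \<Rightarrow> nat \<Rightarrow> nat) \<Rightarrow> nat \<Rightarrow> bool" where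
  "projection_code b c p h \<longleftrightarrow> (\<forall>x<b. \<forall>y<b. x \<in> set_decode (base_code c) \<and> y \<in> set_decode (base_code c) \<longrightarrow>
     digit b h (x * b + y) = p x y)"

text \<open>Reachability of the second projection from the first one, expressed without a bound on the length of the walk.\<close>

definition linked_code :: "nat list \<Rightarrow> nat \<Rightarrow> nat \<Rightarrow> bool" where
  "linked_code ds b c \<longleftrightarrow> (\<forall>S<2 ^ (b ^ (b * b)).
     (\<forall>h<b ^ (b * b). projection_code b c (\<lambda>x y. x) h \<longrightarrow> h \<in> set_decode S) \<and>
     (\<forall>h<b ^ (b * b). \<forall>h'<b ^ (b * b). h \<in> set_decode S \<and> link_step_code ds b c h h' \<longrightarrow> h' \<in> set_decode S) \<longrightarrow>
     (\<exists>h<b ^ (b * b). h \<in> set_decode S \<and> projection_code b c (\<lambda>x y. y) h))"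

text \<open>The code \<open>X\<close> of the family bounds everything: elements and tuple codes are below the code of their
  structure, which is below \<open>X\<close>.\<close>

definition duality_code :: "nat list \<Rightarrow> nat \<Rightarrow> bool" where
  "duality_code ds X \<longleftrightarrow> (\<forall>c<X. c \<in> set_decode X \<longrightarrow>
     core_code ds X c \<and> power_code ds X c \<and> linked_code ds X c \<and>
     (\<forall>c'<X. c' \<in> set_decode X \<and> c \<noteq> c' \<longrightarrow> \<not> hom_to_code ds X c c'))"

lemmas rec_intros = pred_imp pred_all pred_ex pred_ball pred_conj pred_not pred_eq pred_set_decode
  pred_const rec_list_encode rec_digit rec_entry rec_fst_prod_decode rec_snd_prod_decode
  rec_mult rec_add rec_power rec_if rec_const rec_var rec_weaken finite_lessThan

lemma pred_hom_code:
  assumes "recursive n b" "recursive n c" "recursive n c'" "recursive n f"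
  shows "recursive_pred n (\<lambda>xs. hom_code ds (b xs) (c xs) (c' xs) (f xs))"
  unfolding hom_code_def base_code_def rel_code_def by (rule rec_intros assms)+

lemma pred_hom_to_code:
  assumes "recursive n b" "recursive n c" "recursive n c'"
  shows "recursive_pred n (\<lambda>xs. hom_to_code ds (b xs) (c xs) (c' xs))"
  unfolding hom_to_code_def by (rule pred_hom_code rec_intros assms)+

lemma pred_core_code:
  assumes "recursive n b" "recursive n c"
  shows "recursive_pred n (\<lambda>xs. core_code ds (b xs) (c xs))"
  unfolding core_code_def base_code_def by (rule pred_hom_code rec_intros assms)+

lemma pred_power_code:
  assumes "recursive n b" "recursive n c"
  shows "recursive_pred n (\<lambda>xs. power_code ds (b xs) (c xs))"
  unfolding power_code_def consistent_code_def base_code_def rel_code_def by (rule rec_intros assms)+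

lemma pred_linked_code:
  assumes "recursive n b" "recursive n c"
  shows "recursive_pred n (\<lambda>xs. linked_code ds (b xs) (c xs))"
  unfolding linked_code_def link_step_code_def projection_code_def base_code_def rel_code_def
  by (rule rec_intros assms)+

lemma pred_duality_code: "recursive_pred 1 (\<lambda>xs. duality_code ds (hd xs))"
  unfolding duality_code_def One_nat_def
  by (rule pred_hom_to_code pred_core_code pred_power_code pred_linked_code rec_intros)+

section \<open>Correctness of the decision procedure\<close>

lemma less_set_encode: "finite A \<Longrightarrow> x \<in> A \<Longrightarrow> x < set_encode A"
  unfolding set_encode_def using member_le_sum[of x A "(^) (2 :: nat)"] less_exp[of x]
  by (metis le0 less_le_trans)

lemma set_encode_less: 
  assumes "A \<subseteq> {..<b}" shows "set_encode A < 2 ^ b"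
proof -
  have "set_encode A \<le> set_encode {..<b}"
    unfolding set_encode_def using assms by (intro sum_mono2) auto
  also have "set_encode {..<b} < 2 ^ b"
    unfolding set_encode_def by (induction b) (auto simp: lessThan_Suc)
  finally show ?thesis .
qed

lemma set_decode_less: "s < 2 ^ b \<Longrightarrow> set_decode s \<subseteq> {..<b}"
proof
  fix x assume s: "s < 2 ^ b" and x: "x \<in> set_decode s"
  show "x \<in> {..<b}"
  proof (rule ccontr)
    assume "x \<notin> {..<b}"
    then have "(2 :: nat) ^ b \<le> 2 ^ x" by simp
    then have "s < 2 ^ x" using s by (rule less_le_trans[rotated])
    then have "s div 2 ^ x = 0" by simp
    then show False using x by (simp add: set_decode_def)
  qed
qed

lemma le_list_encode: "x \<in> set xs \<Longrightarrow> x \<le> list_encode xs"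
proof (induction xs)
  case (Cons y xs)
  then show ?case
    using le_prod_encode_1[of y "list_encode xs"] le_prod_encode_2[of "list_encode xs" y] by fastforce
qed simp

definition coded :: "'i list \<Rightarrow> nat \<Rightarrow> ('i, nat) rstruct \<Rightarrow> nat \<Rightarrow> bool" where
  "coded ix b D c \<longleftrightarrow>
     set_decode (base_code c) = base D \<and> base D \<subseteq> {..<b} \<and>
     (\<forall>k<length ix. set_decode (rel_code k c) = list_encode ` rel D (ix ! k) \<and>
        list_encode ` rel D (ix ! k) \<subseteq> {..<b})"

lemma structure_code_coded:
  assumes D: "is_structure I \<delta> D" and b: "structure_code ix D \<le> b"
  shows "coded ix b D (structure_code ix D)"
  unfolding coded_def
proof (intro conjI allI impI)
  let ?c = "structure_code ix D"
  have base: "base_code ?c = set_encode (base D)" by (simp add: base_code_def structure_code_def)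
  then show "set_decode (base_code ?c) = base D" using structure_finite[OF D] by simp
  have "set_encode (base D) \<le> ?c" unfolding structure_code_def by (rule le_prod_encode_1)
  then show "base D \<subseteq> {..<b}" using less_set_encode[OF structure_finite[OF D]] b by fastforce
  fix k assume k: "k < length ix"
  have fin: "finite (list_encode ` rel D (ix ! k))" using finite_rel[OF D] by simp
  have "rel_code k ?c = set_encode (list_encode ` rel D (ix ! k))"
    using k by (simp add: rel_code_def structure_code_def entry_list_encode)
  then show "set_decode (rel_code k ?c) = list_encode ` rel D (ix ! k)" using fin by simp
  have "set_encode (list_encode ` rel D (ix ! k)) \<le> list_encode (map (\<lambda>i. set_encode (list_encode ` rel D i)) ix)"
    using k by (intro le_list_encode) simp
  also have "\<dots> \<le> ?c" unfolding structure_code_def by (rule le_prod_encode_2)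
  finally show "list_encode ` rel D (ix ! k) \<subseteq> {..<b}" using less_set_encode[OF fin] b by fastforce
qed

context
  fixes I :: "'i set" and \<delta> :: "'i \<Rightarrow> nat" and ix :: "'i list" and b c :: nat and D :: "('i, nat) rstruct"
  assumes ix: "set ix = I" and D: "is_structure I \<delta> D" and coded: "coded ix b D c"
begin

lemma coded_base: "set_decode (base_code c) = base D"
  using coded by (simp add: coded_def)

lemma coded_bound: "x \<in> base D \<Longrightarrow> x < b"
  using coded by (auto simp: coded_def)

lemma coded_positive: "0 < b"
  using structure_nonempty[OF D] coded_bound by fastforce

lemma coded_all_base: "(\<forall>x<b. x \<in> set_decode (base_code c) \<longrightarrow> P x) \<longleftrightarrow> (\<forall>x\<in>base D. P x)"
  using coded_bound by (auto simp: coded_base)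

lemma coded_all_base2:
  "(\<forall>x<b. \<forall>y<b. x \<in> set_decode (base_code c) \<and> y \<in> set_decode (base_code c) \<longrightarrow> P x y) \<longleftrightarrow>
   (\<forall>x\<in>base D. \<forall>y\<in>base D. P x y)"
  using coded_bound by (auto simp: coded_base)

lemma coded_rel: "k < length ix \<Longrightarrow> set_decode (rel_code k c) = list_encode ` rel D (ix ! k)"
  using coded by (simp add: coded_def)

lemma coded_rel_bound: "k < length ix \<Longrightarrow> t \<in> rel D (ix ! k) \<Longrightarrow> list_encode t < b"
  using coded unfolding coded_def by blast

lemma coded_mem_rel: "k < length ix \<Longrightarrow> list_encode t \<in> set_decode (rel_code k c) \<longleftrightarrow> t \<in> rel D (ix ! k)"
  using inj_image_mem_iff[OF inj_list_encode] by (simp add: coded_rel)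

lemma coded_all_rel:
  "k < length ix \<Longrightarrow> (\<forall>t<b. t \<in> set_decode (rel_code k c) \<longrightarrow> P t) \<longleftrightarrow> (\<forall>t\<in>rel D (ix ! k). P (list_encode t))"
  using coded_rel_bound by (auto simp: coded_rel)

lemma coded_ex_rel:
  "k < length ix \<Longrightarrow> (\<exists>t<b. t \<in> set_decode (rel_code k c) \<and> P t) \<longleftrightarrow> (\<exists>t\<in>rel D (ix ! k). P (list_encode t))"
  using coded_rel_bound by (auto simp: coded_rel)

lemma coded_all_index: "(\<forall>k\<in>{..<length (map \<delta> ix)}. P (ix ! k)) \<longleftrightarrow> (\<forall>i\<in>I. P i)"
  unfolding ix[symmetric] all_set_conv_all_nth by auto

lemma coded_entry: "t \<in> rel D i \<Longrightarrow> l < \<delta> i \<Longrightarrow> entry l (list_encode t) = t ! l"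
  using structure_length[OF D] by (simp add: entry_list_encode)

lemma coded_map: "t \<in> rel D i \<Longrightarrow> map (\<lambda>l. f (entry l (list_encode t))) [0..<\<delta> i] = map f t"
  using structure_length[OF D] coded_entry by (intro nth_equalityI) auto

lemma hom_code_iff:
  assumes D': "is_structure I \<delta> D'" "coded ix b D' c'"
  shows "hom_code (map \<delta> ix) b c c' f \<longleftrightarrow> is_hom I D D' (digit b f)"
proof -
  have "(\<forall>t<b. t \<in> set_decode (rel_code k c) \<longrightarrow>
      list_encode (map (\<lambda>l. digit b f (entry l t)) [0..<map \<delta> ix ! k]) \<in> set_decode (rel_code k c')) \<longleftrightarrow>
    (\<forall>t\<in>rel D (ix ! k). map (digit b f) t \<in> rel D' (ix ! k))" if k: "k < length ix" for k
  proof -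
    have "set_decode (rel_code k c') = list_encode ` rel D' (ix ! k)"
      using D'(2) k by (simp add: coded_def)
    then have "list_encode t \<in> set_decode (rel_code k c') \<longleftrightarrow> t \<in> rel D' (ix ! k)" for t
      using inj_image_mem_iff[OF inj_list_encode] by simp
    then show ?thesis by (simp add: coded_all_rel[OF k] coded_map k)
  qed
  moreover have "set_decode (base_code c') = base D'" using D'(2) by (simp add: coded_def)
  ultimately show ?thesis
    unfolding hom_code_def is_hom_def coded_all_base
    using coded_all_index[of "\<lambda>i. \<forall>t\<in>rel D i. map (digit b f) t \<in> rel D' i"] by auto
qed

lemma hom_digits:
  assumes D': "coded ix b D' c'" and f: "is_hom I D D' f"
  obtains g where "g < b ^ b" "\<And>x. x \<in> base D \<Longrightarrow> digit b g x = f x" "is_hom I D D' (digit b g)"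
proof -
  have bound: "f x < b" if "x \<in> base D" for x
    using is_hom_base[OF f that] D' by (auto simp: coded_def)
  then have "(if x \<in> base D then f x else 0) < b" for x using coded_positive by simp
  then obtain g where g: "g < b ^ b" "\<And>x. x < b \<Longrightarrow> digit b g x = (if x \<in> base D then f x else 0)"
    using digits_exist[of b "\<lambda>x. if x \<in> base D then f x else 0" b] by blast
  have eq: "digit b g x = f x" if "x \<in> base D" for x using g(2) coded_bound[OF that] that by simp
  then have "is_hom I D D' (digit b g)" using is_hom_cong[OF D _ f] by metis
  then show thesis using that g(1) eq by blast
qed

lemma hom_to_code_iff:
  assumes D': "is_structure I \<delta> D'" "coded ix b D' c'"
  shows "hom_to_code (map \<delta> ix) b c c' \<longleftrightarrow> hom_to I D D'"
  unfolding hom_to_code_def hom_to_def hom_code_iff[OF D'] using hom_digits[OF D'(2)] by metis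

lemma core_code_iff: "core_code (map \<delta> ix) b c \<longleftrightarrow> is_core I D"
proof -
  have "core_code (map \<delta> ix) b c \<longleftrightarrow> (\<forall>g<b ^ b. is_hom I D D (digit b g) \<longrightarrow> inj_on (digit b g) (base D))"
    unfolding core_code_def hom_code_iff[OF D coded] inj_on_def using coded_bound
    by (auto simp: coded_base)
  also have "\<dots> \<longleftrightarrow> (\<forall>f. is_hom I D D f \<longrightarrow> inj_on f (base D))"
  proof (intro iffI allI impI)
    fix f assume inj: "\<forall>g<b ^ b. is_hom I D D (digit b g) \<longrightarrow> inj_on (digit b g) (base D)"
      and f: "is_hom I D D f"
    obtain g where g: "g < b ^ b" "\<And>x. x \<in> base D \<Longrightarrow> digit b g x = f x" "is_hom I D D (digit b g)"
      by (rule hom_digits[OF coded f]) blast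
    then show "inj_on f (base D)" using inj inj_on_cong[of "base D" "digit b g" f] by blast
  qed blast
  finally show ?thesis using core_iff_endo_inj[OF D] by simp
qed

lemma power_code_iff: "power_code (map \<delta> ix) b c \<longleftrightarrow> hom_to I (power_structure I \<delta> D) D"
proof -
  let ?U = "power_structure I \<delta> D"
  define consistent where "consistent i u \<longleftrightarrow> (\<forall>j<\<delta> i. digit (2 ^ b) u j \<noteq> 0 \<and>
     (\<forall>d\<in>set_decode (digit (2 ^ b) u j). d \<in> base D \<and> (\<exists>t\<in>rel D i. t ! j = d \<and>
        (\<forall>l<\<delta> i. t ! l \<in> set_decode (digit (2 ^ b) u l)))))" for i u
  have digit_bound: "digit (2 ^ b) u j < 2 ^ b" for u j by (simp add: digit_less)
  have set_bound: "d < b" if "d \<in> set_decode s" "s < 2 ^ b" for d s using set_decode_less that by blast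
  have nonzero: "set_decode s \<noteq> {}" if "s \<noteq> 0" for s :: nat
    using that set_decode_inverse[of s] by fastforce
  have "power_code (map \<delta> ix) b c \<longleftrightarrow> (\<exists>f<b ^ (2 ^ b).
     (\<forall>s<2 ^ b. s \<noteq> 0 \<and> set_decode s \<subseteq> base D \<longrightarrow> digit b f s \<in> base D) \<and>
     (\<forall>i\<in>I. \<forall>u<(2 ^ b) ^ \<delta> i. consistent i u \<longrightarrow>
        map (\<lambda>l. digit b f (digit (2 ^ b) u l)) [0..<\<delta> i] \<in> rel D i))" (is "_ \<longleftrightarrow> ?R")
  proof -
    have sub: "(\<forall>x<b. x \<in> set_decode s \<longrightarrow> x \<in> base D) \<longleftrightarrow> set_decode s \<subseteq> base D" if "s < 2 ^ b" for s
      using set_bound that by blast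
    have cons: "consistent_code (map \<delta> ix) b c k u \<longleftrightarrow> consistent (ix ! k) u"
      if k: "k < length ix" for k u
    proof -
      have "(\<forall>d<b. d \<in> set_decode (digit (2 ^ b) u j) \<longrightarrow> P d) \<longleftrightarrow>
          (\<forall>d\<in>set_decode (digit (2 ^ b) u j). P d)" for P j
        using set_bound digit_bound by blast
      then show ?thesis
        unfolding consistent_code_def coded_base consistent_def coded_ex_rel[OF k]
        using k by (auto simp: coded_entry Ball_def)
    qed
    have "(\<forall>k\<in>{..<length (map \<delta> ix)}. \<forall>u<(2 ^ b) ^ (map \<delta> ix ! k). consistent_code (map \<delta> ix) b c k u \<longrightarrow>
        list_encode (map (\<lambda>l. digit b f (digit (2 ^ b) u l)) [0..<map \<delta> ix ! k]) \<in> set_decode (rel_code k c))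
      \<longleftrightarrow> (\<forall>i\<in>I. \<forall>u<(2 ^ b) ^ \<delta> i. consistent i u \<longrightarrow>
        map (\<lambda>l. digit b f (digit (2 ^ b) u l)) [0..<\<delta> i] \<in> rel D i)" for f
      unfolding coded_all_index[symmetric] using cons coded_mem_rel by (intro ball_cong) auto
    moreover have "(\<forall>s<2 ^ b. s \<noteq> 0 \<and> (\<forall>x<b. x \<in> set_decode s \<longrightarrow> x \<in> base D) \<longrightarrow> P s) \<longleftrightarrow>
        (\<forall>s<2 ^ b. s \<noteq> 0 \<and> set_decode s \<subseteq> base D \<longrightarrow> P s)" for P
      using sub by auto
    ultimately show ?thesis unfolding power_code_def coded_base by (simp only:)
  qed
  also have "?R \<longleftrightarrow> hom_to I ?U D"
  proof
    assume ?R
    then obtain f where f1: "\<And>s. s < 2 ^ b \<Longrightarrow> s \<noteq> 0 \<Longrightarrow> set_decode s \<subseteq> base D \<Longrightarrow> digit b f s \<in> base D"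
      and f2: "\<And>i u. i \<in> I \<Longrightarrow> u < (2 ^ b) ^ \<delta> i \<Longrightarrow> consistent i u \<Longrightarrow>
        map (\<lambda>l. digit b f (digit (2 ^ b) u l)) [0..<\<delta> i] \<in> rel D i"
      by blast
    have S: "set_encode S < 2 ^ b" "set_encode S \<noteq> 0" "set_decode (set_encode S) = S"
      if "S \<subseteq> base D" "S \<noteq> {}" for S
    proof -
      have "finite S" using that structure_finite[OF D] finite_subset by blast
      then show "set_decode (set_encode S) = S" by simp
      then show "set_encode S \<noteq> 0" using that(2) by force
      show "set_encode S < 2 ^ b" using that(1) coded_bound by (intro set_encode_less) auto
    qed
    have "is_hom I ?U D (\<lambda>S. digit b f (set_encode S))"
      unfolding is_hom_def
    proof (intro conjI ballI)
      show "(\<lambda>S. digit b f (set_encode S)) ` base ?U \<subseteq> base D"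
        using f1[OF S(1,2)] S(3) by (auto simp: power_structure_def simp del: set_encode_inverse)
      fix i Ss assume i: "i \<in> I" and "Ss \<in> rel ?U i"
      then have len: "length Ss = \<delta> i" and Ss: "set Ss \<subseteq> {S. S \<noteq> {} \<and> S \<subseteq> base D}"
        and ac: "\<forall>j<\<delta> i. \<forall>d\<in>Ss ! j. \<exists>t\<in>rel D i. t ! j = d \<and> (\<forall>l<\<delta> i. t ! l \<in> Ss ! l)"
        by (auto simp: power_structure_def)
      have Sl: "Ss ! l \<subseteq> base D" "Ss ! l \<noteq> {}" if "l < \<delta> i" for l
        using subsetD[OF Ss nth_mem, of l] that len by simp_all
      have "set_encode (Ss ! l) < 2 ^ b" if "l < \<delta> i" for l using S(1)[OF Sl[OF that]] .
      then obtain u where u: "u < (2 ^ b) ^ \<delta> i" "\<And>l. l < \<delta> i \<Longrightarrow> digit (2 ^ b) u l = set_encode (Ss ! l)"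
        using digits_exist[of "\<delta> i" "\<lambda>l. set_encode (Ss ! l)" "2 ^ b"] by blast
      have dec: "set_decode (digit (2 ^ b) u l) = Ss ! l" if "l < \<delta> i" for l
        using u(2) S(3) Sl that by simp
      have "consistent i u"
        unfolding consistent_def
      proof (intro allI impI conjI ballI)
        fix j assume j: "j < \<delta> i"
        show "digit (2 ^ b) u j \<noteq> 0" using u(2)[OF j] S(2)[OF Sl[OF j]] by simp
        fix d assume "d \<in> set_decode (digit (2 ^ b) u j)"
        then have d: "d \<in> Ss ! j" using dec[OF j] by simp
        then show "d \<in> base D" using Sl(1)[OF j] by blast
        show "\<exists>t\<in>rel D i. t ! j = d \<and> (\<forall>l<\<delta> i. t ! l \<in> set_decode (digit (2 ^ b) u l))"
          using ac j d by (simp add: dec)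
      qed
      then have "map (\<lambda>l. digit b f (digit (2 ^ b) u l)) [0..<\<delta> i] \<in> rel D i" by (rule f2[OF i u(1)])
      moreover have "map (\<lambda>l. digit b f (digit (2 ^ b) u l)) [0..<\<delta> i] = map (\<lambda>S. digit b f (set_encode S)) Ss"
        using len u(2) by (intro nth_equalityI) auto
      ultimately show "map (\<lambda>S. digit b f (set_encode S)) Ss \<in> rel D i" by simp
    qed
    then show "hom_to I ?U D" unfolding hom_to_def by blast
  next
    assume "hom_to I ?U D"
    then obtain g where g: "is_hom I ?U D g" unfolding hom_to_def by blast
    define v where "v s = (if set_decode s \<noteq> {} \<and> set_decode s \<subseteq> base D then g (set_decode s) else 0)" for s
    have gU: "g S \<in> base D" if "S \<noteq> {}" "S \<subseteq> base D" for S
      using is_hom_base[OF g] that by (simp add: power_structure_def)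
    then have "v s < b" for s using coded_bound coded_positive by (simp add: v_def)
    then obtain f where f: "f < b ^ (2 ^ b)" "\<And>s. s < 2 ^ b \<Longrightarrow> digit b f s = v s"
      using digits_exist[of "2 ^ b" v b] by blast
    have "digit b f s \<in> base D" if "s < 2 ^ b" "s \<noteq> 0" "set_decode s \<subseteq> base D" for s
      using f(2) nonzero that gU by (simp add: v_def)
    moreover have "map (\<lambda>l. digit b f (digit (2 ^ b) u l)) [0..<\<delta> i] \<in> rel D i"
      if i: "i \<in> I" and u: "consistent i u" for i u
    proof -
      let ?Ss = "map (\<lambda>l. set_decode (digit (2 ^ b) u l)) [0..<\<delta> i]"
      have Sl: "set_decode (digit (2 ^ b) u l) \<noteq> {}" "set_decode (digit (2 ^ b) u l) \<subseteq> base D" if "l < \<delta> i" for l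
        using u that nonzero unfolding consistent_def by blast+
      then have "?Ss \<in> rel ?U i"
        using i u by (auto simp: power_structure_def consistent_def)
      then have "map g ?Ss \<in> rel D i" by (rule is_hom_rel[OF g i])
      moreover have "map g ?Ss = map (\<lambda>l. digit b f (digit (2 ^ b) u l)) [0..<\<delta> i]"
        using Sl f(2)[OF digit_bound] by (auto simp: v_def)
      ultimately show ?thesis by (simp only:)
    qed
    ultimately show ?R using f(1) by blast
  qed
  finally show ?thesis .
qed

lemma link_step_code_iff:
  "link_step_code (map \<delta> ix) b c h h' \<longleftrightarrow>
     link_step I D (\<lambda>x y. digit b h (x * b + y)) (\<lambda>x y. digit b h' (x * b + y))"
proof -
  let ?H = "\<lambda>x y. digit b h (x * b + y)" and ?H' = "\<lambda>x y. digit b h' (x * b + y)"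
  have rels: "(\<forall>s<b. \<forall>t<b. s \<in> set_decode (rel_code k c) \<and> t \<in> set_decode (rel_code k c) \<longrightarrow> P s t) \<longleftrightarrow>
      (\<forall>s\<in>rel D (ix ! k). \<forall>t\<in>rel D (ix ! k). P (list_encode s) (list_encode t))" if "k < length ix" for k P
    using that coded_rel_bound by (auto simp: coded_rel)
  have maps: "map (\<lambda>l. if l = j then digit b h (entry l (list_encode s) * b + entry l (list_encode t))
           else digit b h' (entry l (list_encode s) * b + entry l (list_encode t))) [0..<\<delta> i] =
      map (\<lambda>l. if l = j then ?H (s ! l) (t ! l) else ?H' (s ! l) (t ! l)) [0..<\<delta> i]"
    if "s \<in> rel D i" "t \<in> rel D i" for s t i j
    using that coded_entry by (intro nth_equalityI) auto
  have "(\<forall>s<b. \<forall>t<b. s \<in> set_decode (rel_code k c) \<and> t \<in> set_decode (rel_code k c) \<longrightarrow>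
        (\<forall>j\<in>{..<map \<delta> ix ! k}. list_encode (map (\<lambda>l. if l = j then digit b h (entry l s * b + entry l t)
           else digit b h' (entry l s * b + entry l t)) [0..<map \<delta> ix ! k]) \<in> set_decode (rel_code k c)))
     \<longleftrightarrow> (\<forall>s\<in>rel D (ix ! k). \<forall>t\<in>rel D (ix ! k). \<forall>j<length s.
        map (\<lambda>l. if l = j then ?H (s ! l) (t ! l) else ?H' (s ! l) (t ! l)) [0..<length s] \<in> rel D (ix ! k))"
    if k: "k < length ix" for k
    unfolding rels[OF k] coded_mem_rel[OF k] nth_map[OF k]
  proof (intro ball_cong refl)
    fix s t assume s: "s \<in> rel D (ix ! k)" and t: "t \<in> rel D (ix ! k)"
    show "(\<forall>j\<in>{..<\<delta> (ix ! k)}. map (\<lambda>l. if l = j then digit b h (entry l (list_encode s) * b + entry l (list_encode t))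
           else digit b h' (entry l (list_encode s) * b + entry l (list_encode t))) [0..<\<delta> (ix ! k)] \<in> rel D (ix ! k))
      \<longleftrightarrow> (\<forall>j<length s. map (\<lambda>l. if l = j then ?H (s ! l) (t ! l) else ?H' (s ! l) (t ! l)) [0..<length s] \<in> rel D (ix ! k))"
      unfolding maps[OF s t] structure_length[OF D s] by blast
  qed
  then show ?thesis
    unfolding link_step_code_def link_step_def coded_all_base2 unfolding coded_base
    using coded_all_index[of "\<lambda>i. \<forall>s\<in>rel D i. \<forall>t\<in>rel D i. \<forall>j<length s.
        map (\<lambda>l. if l = j then ?H (s ! l) (t ! l) else ?H' (s ! l) (t ! l)) [0..<length s] \<in> rel D i"]
    by (simp add: lessThan_def)
qed

text \<open>An operation is determined by its code only on the base set, but it has several codes; this is harmless since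
  steps and projections depend only on the values on the base set. The reachable codes form the least closed set.\<close>

lemma linked_code_iff: "linked_code (map \<delta> ix) b c \<longleftrightarrow> (\<exists>n h. linked_projections I D n h)"
proof -
  define M where "M = b ^ (b * b)"
  define H where "H g = (\<lambda>x y. digit b g (x * b + y))" for g
  define start where "start g \<longleftrightarrow> (\<forall>x\<in>base D. \<forall>y\<in>base D. H g x y = x)" for g
  define final where "final g \<longleftrightarrow> (\<forall>x\<in>base D. \<forall>y\<in>base D. H g x y = y)" for g
  define R where "R = {(g, g'). g < M \<and> g' < M \<and> link_step I D (H g) (H g')}"
  have pos: "x * b + y < b * b" if "x \<in> base D" "y \<in> base D" for x y
  proof -
    have "x * b + y < Suc x * b" using coded_bound[OF that(2)] by simp
    also have "\<dots> \<le> b * b" using coded_bound[OF that(1)] by (intro mult_le_mono1) simp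
    finally show ?thesis .
  qed
  have R: "(g, g') \<in> R \<longleftrightarrow> g < M \<and> g' < M \<and> link_step_code (map \<delta> ix) b c g g'" for g g'
    by (simp add: R_def link_step_code_iff H_def)
  have proj: "projection_code b c (\<lambda>x y. x) = start" "projection_code b c (\<lambda>x y. y) = final"
    unfolding projection_code_def coded_all_base2 start_def final_def H_def by auto
  have "linked_code (map \<delta> ix) b c \<longleftrightarrow> (\<exists>g g'. g < M \<and> g' < M \<and> start g \<and> final g' \<and> (g, g') \<in> R\<^sup>*)"
    (is "_ \<longleftrightarrow> ?reach")
  proof
    assume linked: "linked_code (map \<delta> ix) b c"
    let ?S = "{g'. g' < M \<and> (\<exists>g. g < M \<and> start g \<and> (g, g') \<in> R\<^sup>*)}"
    have dec: "set_decode (set_encode ?S) = ?S" by simp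
    have "set_encode ?S < 2 ^ M" by (rule set_encode_less) auto
    moreover have "\<forall>g<M. start g \<longrightarrow> g \<in> ?S" by auto
    moreover have "\<forall>g<M. \<forall>g'<M. g \<in> ?S \<and> link_step_code (map \<delta> ix) b c g g' \<longrightarrow> g' \<in> ?S"
      using R by (auto intro: rtrancl.rtrancl_into_rtrancl)
    ultimately have "\<exists>g<M. g \<in> ?S \<and> final g"
      using linked unfolding linked_code_def M_def[symmetric] proj by (metis (no_types, lifting) dec)
    then show ?reach by blast
  next
    assume ?reach
    then obtain g g' where g: "g < M" "g' < M" "start g" "final g'" "(g, g') \<in> R\<^sup>*" by blast
    have "g' \<in> set_decode S"
      if "\<forall>h<M. start h \<longrightarrow> h \<in> set_decode S"
        "\<forall>h<M. \<forall>h'<M. h \<in> set_decode S \<and> link_step_code (map \<delta> ix) b c h h' \<longrightarrow> h' \<in> set_decode S" for S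
      using g(5)
    proof (induction rule: rtrancl_induct)
      case base
      then show ?case using that(1) g by blast
    next
      case (step y z)
      then show ?case using that(2) R by blast
    qed
    then show "linked_code (map \<delta> ix) b c"
      unfolding linked_code_def M_def[symmetric] proj using g by blast
  qed
  also have "\<dots> \<longleftrightarrow> (\<exists>n h. linked_projections I D n h)"
  proof
    assume ?reach
    then obtain g g' n where g: "start g" "final g'" "(g, g') \<in> R ^^ n"
      using rtrancl_imp_relpow by blast
    then obtain f where f: "f 0 = g" "f n = g'" "\<forall>i<n. (f i, f (Suc i)) \<in> R"
      unfolding relpow_fun_conv by blast
    have "linked_projections I D n (\<lambda>k. H (f k))"
      using f g by (auto simp: linked_projections_def start_def final_def R_def)
    then show "\<exists>n h. linked_projections I D n h" by blast
  next
    assume "\<exists>n h. linked_projections I D n h"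
    then obtain n h where link: "linked_projections I D n h" by blast
    have step: "link_step I D (h k) (h (Suc k))" if "k < n" for k
      using link that by (simp add: linked_projections_def)
    have closed: "h k x y \<in> base D" if "x \<in> base D" "y \<in> base D" "k \<le> n" for x y k
    proof (cases k)
      case 0
      then show ?thesis using link that by (simp add: linked_projections_def)
    next
      case (Suc m)
      then show ?thesis using step[of m] that by (simp add: link_step_def)
    qed
    have "\<exists>g. g < M \<and> (\<forall>x\<in>base D. \<forall>y\<in>base D. H g x y = h k x y)" if k: "k \<le> n" for k
    proof -
      define v where "v z = (if z div b \<in> base D \<and> z mod b \<in> base D then h k (z div b) (z mod b) else 0)" for z
      have "v z < b" for z using closed[OF _ _ k] coded_bound coded_positive by (simp add: v_def)
      then obtain g where g: "g < M" "\<And>z. z < b * b \<Longrightarrow> digit b g z = v z"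
        using digits_exist[of "b * b" v b] unfolding M_def by blast
      have "H g x y = h k x y" if "x \<in> base D" "y \<in> base D" for x y
        using g(2)[OF pos[OF that]] that coded_bound[OF that(2)] by (simp add: H_def v_def)
      then show ?thesis using g(1) by blast
    qed
    then obtain f where f: "\<And>k. k \<le> n \<Longrightarrow> f k < M"
      "\<And>k x y. k \<le> n \<Longrightarrow> x \<in> base D \<Longrightarrow> y \<in> base D \<Longrightarrow> H (f k) x y = h k x y" by metis
    have "(f k, f (Suc k)) \<in> R" if k: "k < n" for k
    proof -
      have "link_step I D (H (f k)) (H (f (Suc k)))"
        unfolding link_step_def
      proof (intro conjI ballI allI impI)
        show "H (f (Suc k)) x y \<in> base D" if "x \<in> base D" "y \<in> base D" for x y
          using f(2) closed that k by simp
        fix i s t j assume i: "i \<in> I" and s: "s \<in> rel D i" and t: "t \<in> rel D i" and j: "j < length s"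
        have "map (\<lambda>l. if l = j then H (f k) (s ! l) (t ! l) else H (f (Suc k)) (s ! l) (t ! l)) [0..<length s] =
            map (\<lambda>l. if l = j then h k (s ! l) (t ! l) else h (Suc k) (s ! l) (t ! l)) [0..<length s]"
          using f(2) k structure_nth[OF D s] structure_nth[OF D t] structure_length[OF D s] by auto
        also have "\<dots> \<in> rel D i" using step[OF k] i s t j by (simp add: link_step_def)
        finally show "map (\<lambda>l. if l = j then H (f k) (s ! l) (t ! l) else H (f (Suc k)) (s ! l) (t ! l)) [0..<length s] \<in> rel D i" .
      qed
      then show ?thesis using f(1) k by (simp add: R_def)
    qed
    then have "(f 0, f n) \<in> R\<^sup>*" by (meson relpow_fun_conv relpow_imp_rtrancl)
    moreover have "start (f 0)" "final (f n)"
      using f(2) link by (simp_all add: start_def final_def linked_projections_def)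
    ultimately show ?reach using f(1) by blast
  qed
  finally show ?thesis .
qed

end

lemma duality_code_iff:
  fixes \<D> :: "('i, nat) rstruct set"
  assumes type: "is_type I \<delta>" and ix: "set ix = I" and \<D>: "structure_family I \<delta> \<D>"
  shows "duality_code (map \<delta> ix) (family_code ix \<D>) \<longleftrightarrow> (\<exists>\<F>. finite_duality I \<delta> \<F> \<D>)"
proof -
  let ?X = "family_code ix \<D>" and ?ds = "map \<delta> ix"
  have fin: "finite (structure_code ix ` \<D>)" and str: "D \<in> \<D> \<Longrightarrow> is_structure I \<delta> D" for D
    using \<D> by (auto simp: structure_family_def)
  have dec: "set_decode ?X = structure_code ix ` \<D>" using fin by (simp add: family_code_def)
  have less: "structure_code ix D < ?X" if "D \<in> \<D>" for D
    unfolding family_code_def using that by (intro less_set_encode[OF fin]) simp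
  have cod: "coded ix ?X D (structure_code ix D)" if "D \<in> \<D>" for D
    using structure_code_coded[OF str[OF that]] less[OF that] by simp
  have inj: "structure_code ix D = structure_code ix D' \<longleftrightarrow> D = D'" if "D \<in> \<D>" "D' \<in> \<D>" for D D'
    using inj_onD[OF structure_code_inj[OF ix, of \<delta>]] str that by blast
  have "duality_code ?ds ?X \<longleftrightarrow> (\<forall>D\<in>\<D>. core_code ?ds ?X (structure_code ix D) \<and>
      power_code ?ds ?X (structure_code ix D) \<and> linked_code ?ds ?X (structure_code ix D) \<and>
      (\<forall>D'\<in>\<D>. D \<noteq> D' \<longrightarrow> \<not> hom_to_code ?ds ?X (structure_code ix D) (structure_code ix D')))"
    unfolding duality_code_def dec using less inj by (auto simp: image_iff)
  also have "\<dots> \<longleftrightarrow> (\<forall>D\<in>\<D>. is_core I D \<and> hom_to I (power_structure I \<delta> D) D \<and>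
      (\<exists>n h. linked_projections I D n h) \<and> (\<forall>D'\<in>\<D>. D \<noteq> D' \<longrightarrow> \<not> hom_to I D D'))"
    using core_code_iff[OF ix str cod] power_code_iff[OF ix str cod] linked_code_iff[OF ix str cod]
      hom_to_code_iff[OF ix str cod str cod] by simp
  also have "\<dots> \<longleftrightarrow> (\<exists>\<F>. finite_duality I \<delta> \<F> \<D>)"
    unfolding duality_criterion[OF type \<D>] by blast
  finally show ?thesis .
qed

theorem mainTheorem8:
  fixes I :: "'i set" and \<delta> :: "'i \<Rightarrow> nat" and ix :: "'i list"
  assumes "is_type I \<delta>"
    and "distinct ix" and "set ix = I"
  shows "decidable_problem (family_code ix)
           (structure_family I \<delta>)
           (\<lambda>\<D> :: ('i, nat) rstruct set. \<exists>\<F>. finite_duality I \<delta> \<F> \<D>)"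
  unfolding decidable_problem_def
proof (intro exI[of _ "\<lambda>xs. of_bool (duality_code (map \<delta> ix) (hd xs))"] conjI allI impI)
  show "recursive 1 (\<lambda>xs. of_bool (duality_code (map \<delta> ix) (hd xs)))"
    using pred_duality_code unfolding recursive_pred_def .
  fix \<D> :: "('i, nat) rstruct set"
  assume family: "structure_family I \<delta> \<D>"
  show "of_bool (duality_code (map \<delta> ix) (hd [family_code ix \<D>])) =
      (if \<exists>\<F>. finite_duality I \<delta> \<F> \<D> then 1 else 0 :: nat)"
    unfolding list.sel duality_code_iff[OF assms(1,3) family] of_bool_def ..
qed

end
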